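(* Every dynamical system in three dimensions possesses two compatible Poisson vectors. That is, let $\mathbf{v}$ be a smooth vector field on an open subset of $\mathbb{R}^3$ and let $p$ be a point with $\mathbf{v}(p)\neq\mathbf{0}$. Then on some neighborhood of $p$ there exist two smooth vector fields $\mathbf{J}_1,\mathbf{J}_2$, linearly independent at every point, which are compatible Poisson vectors for the system $\dot{\mathbf{x}}=\mathbf{v}(\mathbf{x})$.
   Context: A Poisson vector on an open subset of $\mathbb{R}^3$ is a nowhere zero vector field $\mathbf{J}$ satisfying the Jacobi identity $\mathbf{J}\cdot(\nabla\times\mathbf{J})=0$. It is a Poisson vector for the system $\dot{\mathbf{x}}=\mathbf{v}(\mathbf{x})$ if the system is Hamiltonian with respect to it, i.e. there is a smooth function $H$ with $\mathbf{v}=\mathbf{J}\times\nabla H$. Two Poisson vectors $\mathbf{J}_1,\mathbf{J}_2$ for $\mathbf{v}$ (so that $\mathbf{v}=\mathbf{J}_1\times\nabla H_2=\mathbf{J}_2\times\nabla H_1$ for some functions $H_1,H_2$) are compatible if $\mathbf{J}_1+c\,\mathbf{J}_2$ satisfies the Jacobi identity for every constant $c$. *)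

theory Defs
  imports "HOL-Analysis.Analysis"
begin

text \<open>
  Only meant for open \<open>S\<close>, where derivatives are two-sided. Since the domain is finite-dimensional,
  continuity of all iterated directional derivatives is the usual class \<open>C\<^sup>k\<close>.
\<close>

primrec Ck_on :: "nat \<Rightarrow> 'a::euclidean_space set \<Rightarrow> ('a \<Rightarrow> 'b::real_normed_vector) \<Rightarrow> bool" where
  "Ck_on 0 S f \<longleftrightarrow> continuous_on S f"
| "Ck_on (Suc k) S f \<longleftrightarrow>
     (\<forall>x\<in>S. f differentiable (at x)) \<and> (\<forall>v. Ck_on k S (\<lambda>x. frechet_derivative f (at x) v))"

definition smooth_on :: "'a::euclidean_space set \<Rightarrow> ('a \<Rightarrow> 'b::real_normed_vector) \<Rightarrow> bool" where
  "smooth_on S f \<longleftrightarrow> (\<forall>k. Ck_on k S f)"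

definition gradient :: "(real^'n \<Rightarrow> real) \<Rightarrow> real^'n \<Rightarrow> real^'n" where
  "gradient H x = (\<chi> i. frechet_derivative H (at x) (axis i 1))"

text \<open>Below, \<open>jacobian J (at x) $ i $ j\<close> is the partial derivative of the component \<open>J\<^sub>i\<close> in
  direction \<open>j\<close>.\<close>

definition curl :: "(real^3 \<Rightarrow> real^3) \<Rightarrow> real^3 \<Rightarrow> real^3" where
  "curl J x = (let D = jacobian J (at x) in
     vector [D $ 3 $ 2 - D $ 2 $ 3, D $ 1 $ 3 - D $ 3 $ 1, D $ 2 $ 1 - D $ 1 $ 2])"

definition jacobi_identity_on :: "(real^3) set \<Rightarrow> (real^3 \<Rightarrow> real^3) \<Rightarrow> bool" where
  "jacobi_identity_on U J \<longleftrightarrow> (\<forall>x\<in>U. J x \<bullet> curl J x = 0)"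

definition poisson_vector_on :: "(real^3) set \<Rightarrow> (real^3 \<Rightarrow> real^3) \<Rightarrow> bool" where
  "poisson_vector_on U J \<longleftrightarrow> smooth_on U J \<and> (\<forall>x\<in>U. J x \<noteq> 0) \<and> jacobi_identity_on U J"

definition poisson_vector_for_on ::
    "(real^3) set \<Rightarrow> (real^3 \<Rightarrow> real^3) \<Rightarrow> (real^3 \<Rightarrow> real^3) \<Rightarrow> bool" where
  "poisson_vector_for_on U v J \<longleftrightarrow> poisson_vector_on U J \<and>
     (\<exists>H. smooth_on U H \<and> (\<forall>x\<in>U. v x = cross3 (J x) (gradient H x)))"

definition compatible_on :: "(real^3) set \<Rightarrow> (real^3 \<Rightarrow> real^3) \<Rightarrow> (real^3 \<Rightarrow> real^3) \<Rightarrow> bool" where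
  "compatible_on U J1 J2 \<longleftrightarrow> (\<forall>c::real. jacobi_identity_on U (\<lambda>x. J1 x + c *\<^sub>R J2 x))"

end

theory Submission
  imports Defs
begin

text \<open>
  A nonvanishing field \<open>v\<close> in three dimensions has, near \<open>p\<close>, two first integrals \<open>H1\<close>, \<open>H2\<close> with linearly
  independent gradients. Being orthogonal to both gradients, \<open>v\<close> equals \<open>f (grad H1 \<times> grad H2)\<close> with a
  smooth \<open>f\<close> that has no zeros. Hence \<open>J1 = f grad H1\<close> and \<open>J2 = - f grad H2\<close> satisfy
  \<open>v = J1 \<times> grad H2 = J2 \<times> grad H1\<close>. Every combination \<open>J1 + c J2\<close> is \<open>f\<close> times the gradient of
  \<open>H1 - c H2\<close>, and a field of the form \<open>f grad K\<close> is orthogonal to its curl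
  \<open>grad f \<times> grad K\<close>, because second derivatives commute. This is
  \<open>compatible_pair_from_first_integrals\<close>.

  The first integrals come from the flow \<open>\<phi>\<close> of a rescaled field \<open>u\<close> parallel to \<open>v\<close>: follow the orbit of a
  point to the plane through \<open>p\<close> orthogonal to \<open>v p\<close> and take coordinates there
  (\<open>first_integrals_transverse_to_field\<close>). The substance of the proof is that the flow is smooth jointly in
  the starting point and time, on one neighbourhood for all orders of differentiation (\<open>flow_smooth\<close>).

  For this let \<open>A = Du(\<phi>)\<close>, let \<open>F\<close> solve the equation of variation \<open>F' = A F\<close> with \<open>F = 1\<close> at time \<open>0\<close>, and
  let \<open>G\<close> be the inverse of \<open>F\<close>, which solves \<open>G' = - G A\<close>. A contraction in a space of functions of
  starting point and time yields \<open>\<phi>\<close>, \<open>F\<close>, \<open>G\<close> as continuous functions (\<open>local_flow_exists\<close>). A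
  Gronwall estimate identifies \<open>F\<close> as the derivative of \<open>\<phi>\<close> in the starting point, and the derivative of \<open>F\<close>
  in direction \<open>h\<close> as \<open>F \<integral> G (\<partial>\<^sub>h A) F\<close>. These formulas raise the differentiability class: if \<open>\<phi>\<close> is of
  class \<open>C\<^sup>k\<^sup>+\<^sup>1\<close> and \<open>F\<close>, \<open>G\<close> are of class \<open>C\<^sup>k\<close>, then so is \<open>\<partial>\<^sub>h A\<close>, whence \<open>F\<close> and \<open>G\<close> are of class
  \<open>C\<^sup>k\<^sup>+\<^sup>1\<close> and \<open>\<phi>\<close> of class \<open>C\<^sup>k\<^sup>+\<^sup>2\<close>.
\<close>

section \<open>Calculus of functions of class \<open>C\<^sup>k\<close>\<close>

lemma Ck_on_cong:
  assumes "open S" "\<And>x. x \<in> S \<Longrightarrow> f x = g x" "Ck_on k S f"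
  shows "Ck_on k S g"
  using assms(2,3)
proof (induction k arbitrary: f g)
  case 0
  then show ?case by (simp cong: continuous_on_cong)
next
  case (Suc k)
  have diff: "f differentiable (at x)" if "x \<in> S" for x
    using Suc.prems that by simp
  have eq: "frechet_derivative f (at x) = frechet_derivative g (at x)" if "x \<in> S" for x
    using frechet_derivative_transform_within_open[OF diff[OF that] assms(1) that] Suc.prems(1) by blast
  have "g differentiable (at x)" if "x \<in> S" for x
    using diff[OF that] Suc.prems(1) assms(1) that
    unfolding differentiable_def by (meson has_derivative_transform_within_open)
  moreover have "Ck_on k S (\<lambda>x. frechet_derivative g (at x) v)" for v
    using Suc.IH[of "\<lambda>x. frechet_derivative f (at x) v" "\<lambda>x. frechet_derivative g (at x) v"] eq Suc.prems
    by simp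
  ultimately show ?case by simp
qed

text \<open>Differentiability classes are established throughout by exhibiting a formula for the derivative that
  is itself of class \<open>C\<^sup>k\<close>.\<close>

lemma Ck_on_SucI:
  assumes "open S" "\<And>x. x \<in> S \<Longrightarrow> (f has_derivative f' x) (at x)"
    and "\<And>v. Ck_on k S (\<lambda>x. f' x v)"
  shows "Ck_on (Suc k) S f"
proof -
  have "frechet_derivative f (at x) = f' x" if "x \<in> S" for x
    using frechet_derivative_at[OF assms(2)[OF that]] by simp
  then have "Ck_on k S (\<lambda>x. frechet_derivative f (at x) v)" for v
    by (intro Ck_on_cong[OF assms(1) _ assms(3)]) simp
  then show ?thesis
    using assms(2) unfolding Ck_on.simps(2) differentiable_def by blast
qed

lemma Ck_on_Suc_has_derivative:
  assumes "Ck_on (Suc k) S f" "x \<in> S"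
  shows "(f has_derivative frechet_derivative f (at x)) (at x)"
  using assms frechet_derivative_works by auto

lemma Ck_on_SucD: "Ck_on (Suc k) S f \<Longrightarrow> Ck_on k S f"
proof (induction k arbitrary: f)
  case 0
  then show ?case
    by (auto intro!: continuous_at_imp_continuous_on differentiable_imp_continuous_within)
next
  case (Suc k)
  from Suc.prems have "\<forall>x\<in>S. f differentiable (at x)" "\<And>v. Ck_on (Suc k) S (\<lambda>x. frechet_derivative f (at x) v)"
    by (auto simp only: Ck_on.simps(2))
  with Suc.IH show ?case by simp
qed

lemma Ck_on_le: "Ck_on k S f \<Longrightarrow> j \<le> k \<Longrightarrow> Ck_on j S f"
  by (induction k) (auto simp del: Ck_on.simps(2) simp: le_Suc_eq dest: Ck_on_SucD)

lemma Ck_on_continuous: "Ck_on k S f \<Longrightarrow> continuous_on S f"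
  using Ck_on_le[of k S f 0] by simp

lemma Ck_on_subset: "Ck_on k S f \<Longrightarrow> T \<subseteq> S \<Longrightarrow> Ck_on k T f"
  by (induction k arbitrary: f) (auto intro: continuous_on_subset)

lemma Ck_on_const: "Ck_on k S (\<lambda>x. c)"
  by (induction k arbitrary: c) (auto simp: differentiable_const)

lemma Ck_on_bounded_linear:
  assumes "open S" "bounded_linear L" "Ck_on k S f"
  shows "Ck_on k S (\<lambda>x. L (f x))"
  using assms(3)
proof (induction k arbitrary: f)
  case 0
  then show ?case using bounded_linear.continuous_on[OF assms(2)] by simp
next
  case (Suc k)
  show ?case
  proof (rule Ck_on_SucI[OF assms(1)])
    show "((\<lambda>x. L (f x)) has_derivative (\<lambda>v. L (frechet_derivative f (at x) v))) (at x)" if "x \<in> S" for x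
      using bounded_linear.has_derivative[OF assms(2) Ck_on_Suc_has_derivative[OF Suc.prems that]] .
    show "Ck_on k S (\<lambda>x. L (frechet_derivative f (at x) v))" for v
      using Suc.prems by (intro Suc.IH) simp
  qed
qed

lemma Ck_on_linear:
  assumes "open S" "bounded_linear L"
  shows "Ck_on k S L"
proof (cases k)
  case 0
  then show ?thesis using linear_continuous_on[OF assms(2)] by simp
next
  case (Suc j)
  show ?thesis unfolding Suc
    by (rule Ck_on_SucI[OF assms(1) bounded_linear_imp_has_derivative[OF assms(2)] Ck_on_const])
qed

lemma Ck_on_add:
  assumes "open S" "Ck_on k S f" "Ck_on k S g"
  shows "Ck_on k S (\<lambda>x. f x + g x)"
  using assms(2,3)
proof (induction k arbitrary: f g)
  case 0
  then show ?case by (simp add: continuous_on_add)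
next
  case (Suc k)
  show ?case
  proof (rule Ck_on_SucI[OF assms(1)])
    show "((\<lambda>x. f x + g x) has_derivative
        (\<lambda>v. frechet_derivative f (at x) v + frechet_derivative g (at x) v)) (at x)" if "x \<in> S" for x
      using Suc.prems[THEN Ck_on_Suc_has_derivative, OF that] by (rule has_derivative_add)
    show "Ck_on k S (\<lambda>x. frechet_derivative f (at x) v + frechet_derivative g (at x) v)" for v
      using Suc.prems by (intro Suc.IH) auto
  qed
qed

lemma Ck_on_sum:
  assumes "open S" "\<And>i. i \<in> I \<Longrightarrow> Ck_on k S (f i)"
  shows "Ck_on k S (\<lambda>x. \<Sum>i\<in>I. f i x)"
  using assms(2)
  by (induction I rule: infinite_finite_induct) (auto intro!: Ck_on_const Ck_on_add assms(1))

lemma Ck_on_bilinear: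
  assumes "open S" "bounded_bilinear B" "Ck_on k S f" "Ck_on k S g"
  shows "Ck_on k S (\<lambda>x. B (f x) (g x))"
  using assms(3,4)
proof (induction k arbitrary: f g)
  case 0
  then show ?case using bounded_bilinear.continuous_on[OF assms(2)] by simp
next
  case (Suc k)
  show ?case
  proof (rule Ck_on_SucI[OF assms(1)])
    show "((\<lambda>x. B (f x) (g x)) has_derivative
        (\<lambda>v. B (f x) (frechet_derivative g (at x) v) + B (frechet_derivative f (at x) v) (g x))) (at x)"
      if "x \<in> S" for x
      using Suc.prems[THEN Ck_on_Suc_has_derivative, OF that]
      by (rule bounded_bilinear.FDERIV[OF assms(2)])
    show "Ck_on k S (\<lambda>x. B (f x) (frechet_derivative g (at x) v) + B (frechet_derivative f (at x) v) (g x))" for v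
      using Suc.prems Suc.prems[THEN Ck_on_SucD]
      by (intro Ck_on_add[OF assms(1)] Suc.IH) auto
  qed
qed

lemma linear_eq_sum_Basis:
  assumes "linear L"
  shows "L (v :: 'a::euclidean_space) = (\<Sum>b\<in>Basis. (v \<bullet> b) *\<^sub>R L b)"
proof -
  have "L v = L (\<Sum>b\<in>Basis. (v \<bullet> b) *\<^sub>R b)" by (simp add: euclidean_representation)
  then show ?thesis by (simp add: linear_sum[OF assms] linear_cmul[OF assms])
qed

text \<open>The chain rule is expanded over the basis, so that the derivative of the composite becomes a sum of
  products of \<open>C\<^sup>k\<close> functions; the partial derivatives of \<open>f\<close> composed with \<open>g\<close> are covered by the
  induction hypothesis because \<open>f\<close> is arbitrary there and \<open>g\<close> is fixed.\<close>

lemma Ck_on_compose: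
  fixes f :: "'b::euclidean_space \<Rightarrow> 'c::real_normed_vector" and g :: "'a::euclidean_space \<Rightarrow> 'b"
  assumes "open S" "Ck_on k T f" "Ck_on k S g" "\<And>x. x \<in> S \<Longrightarrow> g x \<in> T"
  shows "Ck_on k S (\<lambda>x. f (g x))"
  using assms(2,3)
proof (induction k arbitrary: f)
  case 0
  then show ?case using continuous_on_compose2[of T f S g] assms(4) by (simp add: image_subset_iff)
next
  case (Suc k)
  let ?D = "\<lambda>x v. \<Sum>b\<in>Basis. (frechet_derivative g (at x) v \<bullet> b) *\<^sub>R frechet_derivative f (at (g x)) b"
  show ?case
  proof (rule Ck_on_SucI[OF assms(1)])
    fix x assume x: "x \<in> S"
    have df: "(f has_derivative frechet_derivative f (at (g x))) (at (g x))"
      using Ck_on_Suc_has_derivative[OF Suc.prems(1)] assms(4) x by blast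
    have "((\<lambda>x. f (g x)) has_derivative (\<lambda>v. frechet_derivative f (at (g x)) (frechet_derivative g (at x) v))) (at x)"
      by (rule has_derivative_compose[OF Ck_on_Suc_has_derivative[OF Suc.prems(2) x] df])
    then show "((\<lambda>x. f (g x)) has_derivative ?D x) (at x)"
      by (simp only: linear_eq_sum_Basis[OF has_derivative_linear[OF df], symmetric])
  next
    fix v
    show "Ck_on k S (\<lambda>x. ?D x v)"
    proof (intro Ck_on_sum Ck_on_bilinear[OF _ bounded_bilinear_scaleR]
        Ck_on_bounded_linear[OF _ bounded_linear_inner_left] assms(1))
      show "Ck_on k S (\<lambda>x. frechet_derivative g (at x) v)" using Suc.prems by simp
      show "Ck_on k S (\<lambda>x. frechet_derivative f (at (g x)) b)" for b
        using Suc.prems Ck_on_SucD[OF Suc.prems(2)] by (intro Suc.IH) auto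
    qed
  qed
qed

lemma Ck_on_Pair:
  assumes "open S" "Ck_on k S f" "Ck_on k S g"
  shows "Ck_on k S (\<lambda>x. (f x, g x))"
proof -
  have "bounded_linear (\<lambda>a. (a, 0))" "bounded_linear (\<lambda>b. (0, b))"
    by (auto intro!: bounded_linear_Pair bounded_linear_ident bounded_linear_zero)
  from Ck_on_add[OF assms(1) Ck_on_bounded_linear[OF assms(1) this(1) assms(2)] Ck_on_bounded_linear[OF assms(1) this(2) assms(3)]]
  show ?thesis by simp
qed

lemma Ck_on_inverse:
  fixes f :: "'a::euclidean_space \<Rightarrow> real"
  assumes "open S" "Ck_on k S f" "\<And>x. x \<in> S \<Longrightarrow> f x \<noteq> 0"
  shows "Ck_on k S (\<lambda>x. inverse (f x))"
  using assms(2)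
proof (induction k)
  case 0
  then show ?case using assms(3) by (simp add: continuous_on_inverse)
next
  case (Suc k)
  note inv = Suc.IH[OF Ck_on_SucD[OF Suc.prems]]
  note mult = Ck_on_bilinear[OF assms(1) bounded_bilinear_mult]
  show ?case
  proof (rule Ck_on_SucI[OF assms(1)])
    show "((\<lambda>x. inverse (f x)) has_derivative
        (\<lambda>v. - (inverse (f x) * frechet_derivative f (at x) v * inverse (f x)))) (at x)" if "x \<in> S" for x
      using Suc.prems[THEN Ck_on_Suc_has_derivative, OF that] assms(3)[OF that]
      by (rule Deriv.has_derivative_inverse[rotated])
    show "Ck_on k S (\<lambda>x. - (inverse (f x) * frechet_derivative f (at x) v * inverse (f x)))" for v
      using Suc.prems
      by (intro Ck_on_bounded_linear[OF assms(1) bounded_linear_minus[OF bounded_linear_ident]] mult inv) simp_all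
  qed
qed

text \<open>The derivative as an element of the normed space of bounded linear maps. Being a finite sum over the
  basis, it is a total function and inherits its differentiability class from the directional
  derivatives; where \<open>f\<close> is differentiable it is the Frechet derivative.\<close>

definition deriv_blinfun :: "('a::euclidean_space \<Rightarrow> 'b::real_normed_vector) \<Rightarrow> 'a \<Rightarrow> 'a \<Rightarrow>\<^sub>L 'b" where
  "deriv_blinfun f x = (\<Sum>b\<in>Basis. blinfun_scaleR_left (frechet_derivative f (at x) b) o\<^sub>L blinfun_inner_left b)"

lemma deriv_blinfun_eq:
  assumes "(f has_derivative f') (at x)"
  shows "blinfun_apply (deriv_blinfun f x) = f'"
proof
  fix v
  have "f' = frechet_derivative f (at x)" by (rule frechet_derivative_at[OF assms])
  then show "deriv_blinfun f x v = f' v"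
    by (subst linear_eq_sum_Basis[OF has_derivative_linear[OF assms]])
      (simp add: deriv_blinfun_def blinfun.sum_left blinfun_inner_left.rep_eq)
qed

lemma Ck_on_Suc_has_deriv_blinfun:
  assumes "Ck_on (Suc k) S f" "x \<in> S"
  shows "(f has_derivative deriv_blinfun f x) (at x)"
  using Ck_on_Suc_has_derivative[OF assms] deriv_blinfun_eq by metis

lemma Ck_on_deriv_blinfun:
  assumes "open S" "Ck_on (Suc k) S f"
  shows "Ck_on k S (deriv_blinfun f)"
proof -
  have "Ck_on k S (\<lambda>x. deriv_blinfun f x)"
    unfolding deriv_blinfun_def
    using assms(2)
    by (intro Ck_on_sum Ck_on_bounded_linear[OF assms(1) bounded_bilinear.bounded_linear_left[OF bounded_bilinear_blinfun_compose]]
        Ck_on_bounded_linear[OF assms(1) bounded_linear_blinfun_scaleR_left] assms(1)) simp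
  then show ?thesis by simp
qed

lemma lipschitz_of_deriv_blinfun_bound:
  assumes "Ck_on (Suc k) S f" "convex K" "K \<subseteq> S"
    and B: "\<And>y. y \<in> K \<Longrightarrow> norm (deriv_blinfun f y) \<le> B"
    and yz: "y \<in> K" "z \<in> K"
  shows "norm (f y - f z) \<le> B * norm (y - z)"
proof (rule differentiable_bound[OF assms(2) _ _ yz])
  show "(f has_derivative deriv_blinfun f x) (at x within K)" if "x \<in> K" for x
    using Ck_on_Suc_has_deriv_blinfun[OF assms(1)] assms(3) that by (blast intro: has_derivative_at_withinI)
  show "onorm (blinfun_apply (deriv_blinfun f x)) \<le> B" if "x \<in> K" for x
    using B[OF that] by (simp add: norm_blinfun.rep_eq)
qed

lemma deriv_blinfun_continuous_on:
  assumes "open S" "Ck_on (Suc k) S f"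
  shows "continuous_on S (deriv_blinfun f)"
  using Ck_on_continuous[OF Ck_on_deriv_blinfun[OF assms]] .

text \<open>On a compact convex set a \<open>C\<^sup>1\<close> function has a first-order remainder that is small uniformly in the
  base point, since its derivative is uniformly continuous there. This makes the error terms below
  uniform along a whole trajectory.\<close>

lemma uniformly_differentiable_on_compact:
  assumes "open S" "Ck_on (Suc k) S f" "compact K" "convex K" "K \<subseteq> S" "0 < (e::real)"
  obtains d where "0 < d"
    "\<And>x y. x \<in> K \<Longrightarrow> y \<in> K \<Longrightarrow> norm (y - x) < d \<Longrightarrow>
      norm (f y - f x - deriv_blinfun f x (y - x)) \<le> e * norm (y - x)"
proof -
  have "uniformly_continuous_on K (deriv_blinfun f)"
    using compact_uniformly_continuous[OF continuous_on_subset[OF deriv_blinfun_continuous_on[OF assms(1,2)] assms(5)] assms(3)] .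
  then obtain d where d: "0 < d"
    "\<And>x y. x \<in> K \<Longrightarrow> y \<in> K \<Longrightarrow> dist y x < d \<Longrightarrow> dist (deriv_blinfun f y) (deriv_blinfun f x) < e"
    unfolding uniformly_continuous_on_def using assms(6) by metis
  show thesis
  proof (rule that[OF d(1)])
    fix x y assume xy: "x \<in> K" "y \<in> K" "norm (y - x) < d"
    have seg: "closed_segment x y \<subseteq> K" using xy assms(4) by (simp add: closed_segment_subset)
    have "norm (f y - f x - deriv_blinfun f x (y - x)) \<le> norm (y - x) * e"
    proof (rule differentiable_bound_linearization[where S = "closed_segment x y"])
      show "x + t *\<^sub>R (y - x) \<in> closed_segment x y" if "t \<in> {0..1}" for t
        using that by (auto simp: in_segment algebra_simps)
      show "(f has_derivative deriv_blinfun f z) (at z within closed_segment x y)" if "z \<in> closed_segment x y" for z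
        using has_derivative_at_withinI[OF Ck_on_Suc_has_deriv_blinfun[OF assms(2)]] that seg assms(5) by blast
      show "onorm (blinfun_apply (deriv_blinfun f z) - blinfun_apply (deriv_blinfun f x)) \<le> e" if "z \<in> closed_segment x y" for z
      proof -
        have "dist z x < d"
          using segment_bound1[OF that] xy(3) by (simp add: dist_norm)
        then have "dist (deriv_blinfun f z) (deriv_blinfun f x) < e"
          using d(2) xy that seg by blast
        then show ?thesis
          by (simp add: dist_norm norm_blinfun.rep_eq minus_blinfun.rep_eq fun_diff_def)
      qed
    qed simp
    then show "norm (f y - f x - deriv_blinfun f x (y - x)) \<le> e * norm (y - x)"
      by (simp add: mult.commute)
  qed
qed

section \<open>Integrals depending on a parameter\<close>

lemma continuous_on_param_integral:
  fixes f :: "'z::topological_space \<times> real \<Rightarrow> 'c::banach"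
  assumes "continuous_on (Z \<times> {0..1}) f"
  shows "continuous_on Z (\<lambda>z. integral {0..1} (\<lambda>\<theta>. f (z, \<theta>)))"
proof -
  have "continuous_on (Z \<times> cbox 0 1) (\<lambda>(z, \<theta>). f (z, \<theta>))" using assms by simp
  from integral_continuous_on_param[OF this] show ?thesis by simp
qed

lemma has_derivative_param_integral:
  fixes f :: "'z::euclidean_space \<times> real \<Rightarrow> 'c::banach"
  assumes "open S" "Ck_on (Suc k) S f" "open Z" "Z \<times> {0..1} \<subseteq> S" "z \<in> Z"
  shows "((\<lambda>z. integral {0..1} (\<lambda>\<theta>. f (z, \<theta>))) has_derivative
    (\<lambda>v. integral {0..1} (\<lambda>\<theta>. frechet_derivative f (at (z, \<theta>)) (v, 0)))) (at z)"
proof -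
  obtain r where r: "0 < r" "ball z r \<subseteq> Z" using assms(3,5) openE by blast
  define inl :: "'z \<Rightarrow>\<^sub>L ('z \<times> real)" where "inl = Blinfun (\<lambda>v. (v, 0))"
  have inl: "inl v = (v, 0)" for v
    unfolding inl_def
    by (subst bounded_linear_Blinfun_apply) (auto intro!: bounded_linear_Pair bounded_linear_ident bounded_linear_zero)
  define f' where "f' z \<theta> = deriv_blinfun f (z, \<theta>) o\<^sub>L inl" for z \<theta>
  have D: "(f has_derivative deriv_blinfun f (w, \<theta>)) (at (w, \<theta>))" if "w \<in> ball z r" "\<theta> \<in> {0..1}" for w \<theta>
    using Ck_on_Suc_has_deriv_blinfun[OF assms(2)] that r assms(4) by blast
  have cont: "continuous_on (ball z r \<times> {0..1}) (\<lambda>(w, \<theta>). f' w \<theta>)"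
  proof -
    have "continuous_on (ball z r \<times> {0..1}) (deriv_blinfun f)"
      using deriv_blinfun_continuous_on[OF assms(1,2)] by (rule continuous_on_subset) (use r assms(4) in blast)
    then have "continuous_on (ball z r \<times> {0..1}) (\<lambda>p. deriv_blinfun f p o\<^sub>L inl)"
      by (intro continuous_intros)
    then show ?thesis by (simp add: f'_def case_prod_unfold)
  qed
  have contf: "continuous_on {0..1} (\<lambda>\<theta>. f (w, \<theta>))" if "w \<in> ball z r" for w
    using Ck_on_continuous[OF assms(2)] by (rule continuous_on_compose2) (use that r assms(4) in \<open>auto intro!: continuous_intros\<close>)
  have "((\<lambda>z. integral (cbox 0 1) (\<lambda>\<theta>. f (z, \<theta>))) has_derivative integral (cbox 0 1) (f' z)) (at z within ball z r)"
  proof (rule leibniz_rule)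
    show "((\<lambda>z. f (z, \<theta>)) has_derivative f' w \<theta>) (at w within ball z r)"
      if "w \<in> ball z r" "\<theta> \<in> cbox 0 1" for w \<theta>
    proof -
      have "((\<lambda>z. f (z, \<theta>)) has_derivative (\<lambda>v. deriv_blinfun f (w, \<theta>) (v, 0))) (at w within ball z r)"
        by (rule has_derivative_compose[where g = f])
          (use that D in \<open>auto intro!: derivative_eq_intros\<close>)
      then show ?thesis by (simp add: f'_def blinfun_compose.rep_eq o_def inl)
    qed
    show "(\<lambda>\<theta>. f (w, \<theta>)) integrable_on cbox 0 1" if "w \<in> ball z r" for w
      using contf[OF that] by (simp add: integrable_continuous_interval)
  qed (use r cont in auto)
  moreover have "blinfun_apply (integral {0..1} (f' z)) v = integral {0..1} (\<lambda>\<theta>. frechet_derivative f (at (z, \<theta>)) (v, 0))" for v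
  proof -
    have "continuous_on {0..1} (\<lambda>\<theta>. (\<lambda>(w, \<theta>). f' w \<theta>) (z, \<theta>))"
      by (rule continuous_on_compose2[OF cont]) (use r in \<open>auto intro!: continuous_intros\<close>)
    then have "f' z integrable_on {0..1}"
      by (simp add: integrable_continuous_interval)
    from integral_linear[OF this blinfun.bounded_linear_left, of v]
    have "blinfun_apply (integral {0..1} (f' z)) v = integral {0..1} (\<lambda>\<theta>. f' z \<theta> v)"
      by (simp add: o_def)
    also have "\<dots> = integral {0..1} (\<lambda>\<theta>. frechet_derivative f (at (z, \<theta>)) (v, 0))"
      using frechet_derivative_at[OF D] r by (intro integral_cong) (simp add: f'_def inl)
    finally show ?thesis .
  qed
  then have "blinfun_apply (integral {0..1} (f' z)) = (\<lambda>v. integral {0..1} (\<lambda>\<theta>. frechet_derivative f (at (z, \<theta>)) (v, 0)))"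
    by blast
  ultimately show ?thesis
    using r by (simp add: at_within_open[of z "ball z r"])
qed

text \<open>The directional derivative of the integral is the integral of the directional derivative, an integral
  of the same kind, so the class is obtained by induction.\<close>

lemma Ck_on_param_integral:
  fixes f :: "'z::euclidean_space \<times> real \<Rightarrow> 'c::banach"
  assumes "open S" "open Z" "Z \<times> {0..1} \<subseteq> S" "Ck_on k S f"
  shows "Ck_on k Z (\<lambda>z. integral {0..1} (\<lambda>\<theta>. f (z, \<theta>)))"
  using assms(4)
proof (induction k arbitrary: f)
  case 0
  then have "continuous_on (Z \<times> {0..1}) f" using continuous_on_subset assms(3) by auto
  from continuous_on_param_integral[OF this] show ?case by simp
next
  case (Suc k)
  show ?case
  proof (rule Ck_on_SucI[OF assms(2)])
    show "((\<lambda>z. integral {0..1} (\<lambda>\<theta>. f (z, \<theta>))) has_derivative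
      (\<lambda>v. integral {0..1} (\<lambda>\<theta>. frechet_derivative f (at (z, \<theta>)) (v, 0)))) (at z)" if "z \<in> Z" for z
      by (rule has_derivative_param_integral[OF assms(1) Suc.prems assms(2,3) that])
    show "Ck_on k Z (\<lambda>z. integral {0..1} (\<lambda>\<theta>. frechet_derivative f (at (z, \<theta>)) (v, 0)))" for v
      using Suc.IH[of "\<lambda>p. frechet_derivative f (at p) (v, 0)"] Suc.prems by simp
  qed
qed

text \<open>The integral of \<open>g\<close> from \<open>0\<close> to \<open>t\<close>, rescaled to a fixed interval. This form treats both signs of
  \<open>t\<close> alike and shows the dependence on \<open>t\<close> as that of an integral depending on a parameter.\<close>

definition primitive :: "(real \<Rightarrow> 'c::banach) \<Rightarrow> real \<Rightarrow> 'c" where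
  "primitive g t = t *\<^sub>R integral {0..1} (\<lambda>\<theta>. g (\<theta> * t))"

lemma primitive_0 [simp]: "primitive g 0 = 0"
  by (simp add: primitive_def)

lemma scale_mem_symmetric_interval:
  fixes t T \<theta> :: real
  assumes "\<theta> \<in> {0..1}" "t \<in> {-T..T}"
  shows "\<theta> * t \<in> {-T..T}"
proof -
  have "\<bar>\<theta> * t\<bar> \<le> 1 * \<bar>t\<bar>" using assms by (simp only: abs_mult) (intro mult_right_mono, auto)
  then show ?thesis using assms by (auto simp: abs_le_iff)
qed

lemma primitive_eq:
  fixes P :: "real \<Rightarrow> 'c::banach"
  assumes P: "\<And>s. s \<in> {-T..T} \<Longrightarrow> (P has_vector_derivative g s) (at s within {-T..T})"
    and t: "t \<in> {-T..T}"
  shows "primitive g t = P t - P 0"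
proof -
  have "((\<lambda>\<theta>. t *\<^sub>R g (\<theta> * t)) has_integral (P (1 * t) - P (0 * t))) {0..1}"
  proof (rule fundamental_theorem_of_calculus)
    fix \<theta> :: real assume \<theta>: "\<theta> \<in> {0..1}"
    have "((\<lambda>\<theta>. \<theta> * t) has_vector_derivative t) (at \<theta> within {0..1})"
      by (auto intro!: derivative_eq_intros)
    moreover have "(P has_vector_derivative g (\<theta> * t)) (at (\<theta> * t) within (\<lambda>\<theta>. \<theta> * t) ` {0..1})"
      using P[OF scale_mem_symmetric_interval[OF \<theta> t]]
      by (rule has_vector_derivative_within_subset) (use scale_mem_symmetric_interval[OF _ t] in auto)
    ultimately show "((\<lambda>\<theta>. P (\<theta> * t)) has_vector_derivative t *\<^sub>R g (\<theta> * t)) (at \<theta> within {0..1})"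
      using vector_diff_chain_within by (fastforce simp: o_def)
  qed simp
  then show ?thesis unfolding primitive_def by (simp add: integral_unique flip: integral_cmul)
qed

lemma primitive_has_vector_derivative:
  fixes g :: "real \<Rightarrow> 'c::banach"
  assumes "continuous_on {-T..T} g" "t \<in> {-T..T}"
  shows "(primitive g has_vector_derivative g t) (at t within {-T..T})"
proof -
  obtain P where P: "\<And>s. s \<in> {-T..T} \<Longrightarrow> (P has_vector_derivative g s) (at s within {-T..T})"
    using antiderivative_continuous[OF assms(1)] by metis
  have "((\<lambda>t. P t - P 0) has_vector_derivative g t) (at t within {-T..T})"
    using P[OF assms(2)] by (auto intro!: derivative_eq_intros)
  then show ?thesis
    by (rule has_vector_derivative_transform[OF assms(2), rotated]) (use primitive_eq[OF P] in auto)
qed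

section \<open>Symmetry of the second derivative\<close>

text \<open>The increment \<open>f (y + s v) - f y\<close> is \<open>s\<close> times an average of the derivative in direction \<open>v\<close>.
  Differentiating in direction \<open>w\<close> under the integral, dividing by \<open>s\<close> and letting \<open>s\<close> tend to \<open>0\<close>
  exchanges the two derivatives.\<close>

lemma second_derivative_symmetric:
  fixes f :: "'a::euclidean_space \<Rightarrow> real"
  assumes "open S" "Ck_on (Suc (Suc 0)) S f" "x \<in> S"
  shows "frechet_derivative (\<lambda>y. frechet_derivative f (at y) v) (at x) w =
    frechet_derivative (\<lambda>y. frechet_derivative f (at y) w) (at x) v"
proof -
  define D where "D v y = frechet_derivative f (at y) v" for v y
  have C1: "Ck_on (Suc 0) S (D v)" for v using assms(2) unfolding D_def by simp
  have contDD: "continuous_on S (\<lambda>y. frechet_derivative (D v) (at y) w)"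
    using C1 by simp
  obtain r where r: "0 < r" "ball x r \<subseteq> S" using assms(1,3) openE by blast
  define d where "d = r / (norm v + 1)"
  have d: "0 < d" using r by (simp add: d_def add_nonneg_pos)
  have dv: "norm (s *\<^sub>R v) < r" if "\<bar>s\<bar> \<le> d" for s
  proof -
    have "\<bar>s\<bar> * norm v \<le> d * norm v" using that by (simp add: mult_right_mono)
    also have "\<dots> < d * (norm v + 1)" using d by simp
    also have "\<dots> = r" unfolding d_def using norm_ge_zero[of v] by (simp add: add_nonneg_eq_0_iff)
    finally show ?thesis by simp
  qed
  define I where "I s = integral {0..1} (\<lambda>\<theta>. frechet_derivative (D v) (at (x + (\<theta> * s) *\<^sub>R v)) w)" for s
  have inS: "x + (\<theta> * s) *\<^sub>R v \<in> S" if "\<theta> \<in> {0..1}" "s \<in> {-d..d}" for \<theta> s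
  proof -
    have "\<bar>\<theta> * s\<bar> \<le> d" using scale_mem_symmetric_interval[OF that] by (simp add: abs_le_iff)
    then show ?thesis using dv[of "\<theta> * s"] r by (auto simp: dist_norm subset_iff)
  qed
  have I_cont: "continuous_on {-d..d} I"
  proof -
    have "continuous_on ({-d..d} \<times> {0..1}) (\<lambda>p. frechet_derivative (D v) (at (x + (snd p * fst p) *\<^sub>R v)) w)"
      by (rule continuous_on_compose2[OF contDD]) (auto intro!: continuous_intros inS)
    from continuous_on_param_integral[OF this] show ?thesis by (simp add: I_def[abs_def])
  qed
  have eq: "D w (x + s *\<^sub>R v) - D w x = s * I s" if s: "s \<in> {-d..d}" for s
  proof -
    define S' where "S' = {p. fst p + (snd p * s) *\<^sub>R v \<in> S}"
    have S'_vim: "S' = (\<lambda>p. fst p + (snd p * s) *\<^sub>R v) -` S" by (auto simp: S'_def)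
    have oS': "open S'" unfolding S'_vim
      by (rule open_vimage[OF assms(1)]) (intro continuous_intros)
    \<comment> \<open>for base points within \<open>e\<close> of \<open>x\<close>, the segment of the increment stays in \<open>S\<close>\<close>
    define e where "e = r - norm (s *\<^sub>R v)"
    have e: "0 < e" using dv[of s] s by (auto simp: e_def)
    define Z where "Z = ball x e"
    have ZS: "y + (\<theta> * s) *\<^sub>R v \<in> S" if "y \<in> Z" "\<theta> \<in> {0..1}" for y \<theta>
    proof -
      have "norm ((\<theta> * s) *\<^sub>R v) \<le> 1 * norm (s *\<^sub>R v)"
        using that by (auto simp: abs_mult mult.assoc intro!: mult_left_le_one_le)
      then have "norm (y + (\<theta> * s) *\<^sub>R v - x) < r"
        using that norm_triangle_ineq[of "y - x" "(\<theta> * s) *\<^sub>R v"]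
        by (auto simp: Z_def e_def dist_norm norm_minus_commute algebra_simps)
      then show ?thesis using r by (auto simp: dist_norm norm_minus_commute subset_iff)
    qed
    let ?g = "\<lambda>p. D v (fst p + (snd p * s) *\<^sub>R v)"
    have lin: "bounded_linear (\<lambda>p. fst p + (snd p * s) *\<^sub>R v)"
      by (intro bounded_linear_intros)
    have C1g: "Ck_on (Suc 0) S' ?g"
      by (rule Ck_on_compose[OF oS' C1 Ck_on_linear[OF oS' lin]]) (simp add: S'_def)
    have der: "((\<lambda>y. integral {0..1} (\<lambda>\<theta>. ?g (y, \<theta>))) has_derivative
       (\<lambda>u. integral {0..1} (\<lambda>\<theta>. frechet_derivative ?g (at (x, \<theta>)) (u, 0)))) (at x)"
      by (rule has_derivative_param_integral[OF oS' C1g, where Z = Z])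
        (use ZS e in \<open>auto simp: S'_def Z_def\<close>)
    have I_eq: "integral {0..1} (\<lambda>\<theta>. frechet_derivative ?g (at (x, \<theta>)) (w, 0)) = I s"
      unfolding I_def
    proof (rule integral_cong)
      fix \<theta> :: real assume \<theta>: "\<theta> \<in> {0..1}"
      have "(?g has_derivative (\<lambda>p. frechet_derivative (D v) (at (x + (\<theta> * s) *\<^sub>R v)) (fst p + (snd p * s) *\<^sub>R v))) (at (x, \<theta>))"
        by (rule has_derivative_compose[OF bounded_linear_imp_has_derivative[OF lin]])
          (use Ck_on_Suc_has_derivative[OF C1 inS[OF \<theta> s]] in simp)
      from fun_cong[OF frechet_derivative_at[OF this], of "(w, 0)"]
      show "frechet_derivative ?g (at (x, \<theta>)) (w, 0) = frechet_derivative (D v) (at (x + (\<theta> * s) *\<^sub>R v)) w"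
        by simp
    qed
    have incr: "f (y + s *\<^sub>R v) - f y = s * integral {0..1} (\<lambda>\<theta>. ?g (y, \<theta>))" if y: "y \<in> Z" for y
    proof -
      have "((\<lambda>\<theta>. s *\<^sub>R ?g (y, \<theta>)) has_integral (f (y + (1 * s) *\<^sub>R v) - f (y + (0 * s) *\<^sub>R v))) {0..1}"
      proof (rule fundamental_theorem_of_calculus)
        fix \<theta> :: real assume \<theta>: "\<theta> \<in> {0..1}"
        have "((\<lambda>\<theta>. f (y + (\<theta> * s) *\<^sub>R v)) has_derivative
            (\<lambda>h. frechet_derivative f (at (y + (\<theta> * s) *\<^sub>R v)) ((h * s) *\<^sub>R v))) (at \<theta> within {0..1})"
          by (rule has_derivative_compose[where g = f])
            (use Ck_on_Suc_has_derivative[OF assms(2) ZS[OF y \<theta>]] in \<open>auto intro!: derivative_eq_intros\<close>)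
        moreover have "linear (frechet_derivative f (at (y + (\<theta> * s) *\<^sub>R v)))"
          using has_derivative_linear[OF Ck_on_Suc_has_derivative[OF assms(2) ZS[OF y \<theta>]]] .
        ultimately show "((\<lambda>\<theta>. f (y + (\<theta> * s) *\<^sub>R v)) has_vector_derivative s *\<^sub>R ?g (y, \<theta>)) (at \<theta> within {0..1})"
          by (simp add: has_vector_derivative_def D_def linear_cmul mult.assoc)
      qed simp
      then show ?thesis by (simp add: integral_unique flip: integral_mult_right)
    qed
    have "((\<lambda>y. f (y + s *\<^sub>R v) - f y) has_derivative (\<lambda>u. D u (x + s *\<^sub>R v) - D u x)) (at x)"
    proof (rule has_derivative_diff)
      have "x + s *\<^sub>R v \<in> S" using ZS[of x 1] e by (simp add: Z_def)
      then show "((\<lambda>y. f (y + s *\<^sub>R v)) has_derivative (\<lambda>u. D u (x + s *\<^sub>R v))) (at x)"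
        unfolding D_def
        by (intro has_derivative_compose[where g = f, OF _ Ck_on_Suc_has_derivative[OF assms(2)]])
          (auto intro!: derivative_eq_intros simp del: Ck_on.simps)
      show "(f has_derivative (\<lambda>u. D u x)) (at x)"
        unfolding D_def by (rule Ck_on_Suc_has_derivative[OF assms(2,3)])
    qed
    moreover have "((\<lambda>y. f (y + s *\<^sub>R v) - f y) has_derivative
       (\<lambda>u. s * integral {0..1} (\<lambda>\<theta>. frechet_derivative ?g (at (x, \<theta>)) (u, 0)))) (at x)"
      by (rule has_derivative_transform_within_open[OF has_derivative_mult_right[OF der], of Z])
        (use e incr in \<open>auto simp: Z_def\<close>)
    ultimately have "(\<lambda>u. D u (x + s *\<^sub>R v) - D u x) =
        (\<lambda>u. s * integral {0..1} (\<lambda>\<theta>. frechet_derivative ?g (at (x, \<theta>)) (u, 0)))"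
      by (rule has_derivative_unique)
    from fun_cong[OF this, of w] show ?thesis using I_eq by simp
  qed
  have "((\<lambda>s. D w (x + s *\<^sub>R v)) has_derivative (\<lambda>h. frechet_derivative (D w) (at x) (h *\<^sub>R v))) (at 0)"
    by (rule has_derivative_compose[where g = "D w"])
      (use Ck_on_Suc_has_derivative[OF C1 assms(3)] in \<open>auto intro!: derivative_eq_intros\<close>)
  moreover have "linear (frechet_derivative (D w) (at x))"
    using has_derivative_linear[OF Ck_on_Suc_has_derivative[OF C1 assms(3)]] .
  ultimately have "((\<lambda>s. D w (x + s *\<^sub>R v)) has_field_derivative frechet_derivative (D w) (at x) v) (at 0)"
    unfolding has_field_derivative_def by (simp add: linear_cmul mult_commute_abs)
  then have lim: "((\<lambda>h. (D w (x + h *\<^sub>R v) - D w x) / h) \<longlongrightarrow> frechet_derivative (D w) (at x) v) (at 0)"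
    by (simp add: DERIV_def)
  have "(I \<longlongrightarrow> I 0) (at 0)"
    using I_cont d by (metis atLeastAtMost_iff at_within_Icc_at continuous_on_def less_eq_real_def neg_less_0_iff_less)
  then have "((\<lambda>h. (D w (x + h *\<^sub>R v) - D w x) / h) \<longlongrightarrow> I 0) (at 0)"
    by (rule Lim_transform_within_open[of _ _ _ _ "{-d<..<d}"]) (use d eq in auto)
  from tendsto_unique[OF _ lim this] have "frechet_derivative (D w) (at x) v = I 0" by simp
  also have "\<dots> = frechet_derivative (D v) (at x) w" by (simp add: I_def)
  finally show ?thesis by (simp add: D_def[abs_def])
qed

section \<open>Ordinary differential equations on a unit time interval\<close>

lemma norm_le_derivative_bound:
  fixes y :: "real \<Rightarrow> 'b::real_normed_vector"
  assumes der: "\<And>s. s \<in> {-T..T} \<Longrightarrow> (y has_vector_derivative y' s) (at s within {-T..T})"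
    and bound: "\<And>s. s \<in> {-T..T} \<Longrightarrow> norm (y' s) \<le> B"
    and "y 0 = 0" and t: "t \<in> {-T..T}"
  shows "norm (y t) \<le> B * \<bar>t\<bar>"
proof -
  have "norm (y t - y 0) \<le> B * norm (t - 0)"
  proof (rule differentiable_bound[where S = "{-T..T}"])
    show "(y has_derivative (\<lambda>h. h *\<^sub>R y' s)) (at s within {-T..T})" if "s \<in> {-T..T}" for s
      using der[OF that] by (simp add: has_vector_derivative_def)
    show "onorm (\<lambda>h. h *\<^sub>R y' s) \<le> B" if "s \<in> {-T..T}" for s
      using mult_right_mono[OF bound[OF that] abs_ge_zero] by (intro onorm_le) (simp add: mult.commute)
  qed (use t in auto)
  then show ?thesis using assms(3) by simp
qed

text \<open>On a time interval of length at most one on each side of \<open>0\<close>, a Lipschitz constant of at most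
  \<open>1/2\<close> replaces Gronwall's exponential estimate: at a maximum point \<open>m\<close> of \<open>norm (y s)\<close> the mean value
  inequality gives \<open>norm (y m) \<le> norm (y m) / 2 + c\<close>. The uniqueness and differentiability
  arguments for solutions rest on this estimate.\<close>

lemma gronwall_unit_interval:
  fixes y :: "real \<Rightarrow> 'b::real_normed_vector"
  assumes der: "\<And>s. s \<in> {-T..T} \<Longrightarrow> (y has_vector_derivative y' s) (at s within {-T..T})"
    and bound: "\<And>s. s \<in> {-T..T} \<Longrightarrow> norm (y' s) \<le> 1/2 * norm (y s) + c"
    and "y 0 = 0" and T: "T \<le> 1" and t: "t \<in> {-T..T}"
  shows "norm (y t) \<le> 2 * c"
proof -
  have "continuous_on {-T..T} (\<lambda>s. norm (y s))"
    using has_vector_derivative_continuous[OF der]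
    by (intro continuous_on_norm) (simp add: continuous_on_eq_continuous_within)
  then obtain m where m: "m \<in> {-T..T}" "\<And>s. s \<in> {-T..T} \<Longrightarrow> norm (y s) \<le> norm (y m)"
    using continuous_attains_sup[of "{-T..T}" "\<lambda>s. norm (y s)"] t by auto
  have B: "norm (y' s) \<le> 1/2 * norm (y m) + c" if "s \<in> {-T..T}" for s
    using bound[OF that] m(2)[OF that] by simp
  have "norm (y m) \<le> (1/2 * norm (y m) + c) * \<bar>m\<bar>"
    by (rule norm_le_derivative_bound[OF der B assms(3) m(1)])
  also have "\<dots> \<le> (1/2 * norm (y m) + c) * 1"
    using m(1) T order_trans[OF norm_ge_zero B[OF m(1)]] by (intro mult_left_mono) auto
  finally show ?thesis using m(2)[OF t] by simp
qed

text \<open>The contraction is carried out in the space of bounded continuous functions of parameter and time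
  together, so that continuity in the parameter is part of the fixed point. Time is truncated to
  \<open>[-1, 1]\<close>, where the Lipschitz constant \<open>1/2\<close> makes the integral operator a contraction.\<close>

lemma ode_solution_continuous_in_parameter:
  fixes g :: "'p::metric_space \<times> real \<Rightarrow> 'b::banach \<Rightarrow> 'b"
  assumes cont: "continuous_on UNIV (\<lambda>q. g (fst q) (snd q))"
    and lip: "\<And>q y z. norm (g q y - g q z) \<le> 1/2 * norm (y - z)"
    and bdd: "\<And>q. norm (g q 0) \<le> M"
  obtains y where "continuous_on UNIV y" "\<And>x. y (x, 0) = 0"
    "\<And>x t. t \<in> {-1..1} \<Longrightarrow>
      ((\<lambda>s. y (x, s)) has_vector_derivative g (x, t) (y (x, t))) (at t within {-1..1})"
proof -
  define c :: "real \<Rightarrow> real" where "c t = max (-1) (min 1 t)" for t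
  have c: "\<bar>c t\<bar> \<le> 1" for t by (auto simp: c_def)
  have c_cont: "continuous_on UNIV c" unfolding c_def by (intro continuous_intros)
  define P where "P \<phi> q \<theta> = g (fst q, \<theta> * c (snd q)) (apply_bcontfun \<phi> (fst q, \<theta> * c (snd q)))" for \<phi> q \<theta>
  define \<Phi> where "\<Phi> \<phi> q = c (snd q) *\<^sub>R integral {0..1} (P \<phi> q)" for \<phi> q
  have P_cont: "continuous_on (UNIV \<times> {0..1}) (\<lambda>r. P \<phi> (fst r) (snd r))" for \<phi> :: "('p \<times> real) \<Rightarrow>\<^sub>C 'b"
  proof -
    have "continuous_on (UNIV \<times> {0..1}) (\<lambda>r. (fst (fst r), snd r * c (snd (fst r))) :: 'p \<times> real)"
      by (intro continuous_intros continuous_on_compose2[OF c_cont]) auto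
    from continuous_on_compose2[OF continuous_on_apply_bcontfun[of UNIV \<phi>] this]
    have "continuous_on (UNIV \<times> {0..1}) (\<lambda>r. ((fst (fst r), snd r * c (snd (fst r))), \<phi> (fst (fst r), snd r * c (snd (fst r)))))"
      by (intro continuous_intros continuous_on_compose2[OF c_cont]) auto
    from continuous_on_compose2[OF cont this]
    show ?thesis by (simp add: P_def)
  qed
  have P_cont1: "continuous_on {0..1} (P \<phi> q)" for \<phi> q
  proof -
    have "continuous_on {0..1} (\<lambda>\<theta>. (q, \<theta>))" by (intro continuous_intros)
    from continuous_on_compose2[OF P_cont this, of \<phi>] show ?thesis by force
  qed
  have P_bound: "norm (P \<phi> q \<theta>) \<le> 1/2 * norm \<phi> + M" for \<phi> q \<theta>
  proof -
    let ?q = "(fst q, \<theta> * c (snd q))"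
    have "norm (P \<phi> q \<theta>) \<le> norm (g ?q (\<phi> ?q) - g ?q 0) + norm (g ?q 0)"
      unfolding P_def using norm_triangle_sub by (simp add: add.commute)
    then show ?thesis using lip[of ?q "\<phi> ?q" 0] bdd[of ?q] norm_bounded[of \<phi> ?q] by simp
  qed
  have \<Phi>_cont: "continuous_on UNIV (\<Phi> \<phi>)" for \<phi>
    unfolding \<Phi>_def
    using continuous_on_param_integral[OF P_cont[of \<phi>]]
    by (intro continuous_intros continuous_on_compose2[OF c_cont]) auto
  have scale: "norm (c t *\<^sub>R z) \<le> norm z" for t and z :: 'b
    using c[of t] by (simp add: mult_left_le_one_le)
  have "norm (\<Phi> \<phi> q) \<le> 1/2 * norm \<phi> + M" for \<phi> q
    using order_trans[OF scale integral_bound[OF _ P_cont1 P_bound]] by (simp add: \<Phi>_def)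
  then have \<Phi>_bcontfun: "\<Phi> \<phi> \<in> bcontfun" for \<phi> by (rule bcontfun_normI[OF \<Phi>_cont])
  have "dist (Bcontfun (\<Phi> \<phi>)) (Bcontfun (\<Phi> \<psi>)) \<le> 1/2 * dist \<phi> \<psi>" for \<phi> \<psi>
  proof (rule dist_bound)
    fix q
    have "integral {0..1} (P \<phi> q) - integral {0..1} (P \<psi> q) = integral {0..1} (\<lambda>\<theta>. P \<phi> q \<theta> - P \<psi> q \<theta>)"
      using P_cont1 by (intro integral_diff[symmetric] integrable_continuous_interval)
    moreover have "norm (integral {0..1} (\<lambda>\<theta>. P \<phi> q \<theta> - P \<psi> q \<theta>)) \<le> (1/2 * dist \<phi> \<psi>) * (1 - 0)"
    proof (rule integral_bound)
      show "norm (P \<phi> q \<theta> - P \<psi> q \<theta>) \<le> 1/2 * dist \<phi> \<psi>" for \<theta>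
        unfolding P_def using lip dist_bounded[of \<phi> _ \<psi>]
        by (smt (verit) dist_norm field_sum_of_halves mult_left_mono)
      show "continuous_on {0..1} (\<lambda>\<theta>. P \<phi> q \<theta> - P \<psi> q \<theta>)" by (intro continuous_on_diff P_cont1)
    qed simp
    ultimately have "norm (integral {0..1} (P \<phi> q) - integral {0..1} (P \<psi> q)) \<le> 1/2 * dist \<phi> \<psi>" by simp
    from order_trans[OF scale this]
    have "norm (c (snd q) *\<^sub>R (integral {0..1} (P \<phi> q) - integral {0..1} (P \<psi> q))) \<le> 1/2 * dist \<phi> \<psi>" .
    then show "dist (Bcontfun (\<Phi> \<phi>) q) (Bcontfun (\<Phi> \<psi>) q) \<le> 1/2 * dist \<phi> \<psi>"
      by (simp add: Bcontfun_inverse[OF \<Phi>_bcontfun] \<Phi>_def dist_norm scaleR_diff_right)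
  qed
  then obtain \<phi> where "Bcontfun (\<Phi> \<phi>) = \<phi>"
    using banach_fix_type[of "1/2" "\<lambda>\<phi>. Bcontfun (\<Phi> \<phi>)"] by auto
  then have fp: "apply_bcontfun \<phi> = \<Phi> \<phi>" by (metis Bcontfun_inverse[OF \<Phi>_bcontfun])
  have prim: "\<phi> (x, t) = primitive (\<lambda>s. g (x, s) (\<phi> (x, s))) t" if "t \<in> {-1..1}" for x :: 'p and t
    using that by (subst fp) (simp add: \<Phi>_def P_def[abs_def] primitive_def c_def)
  show thesis
  proof (rule that[of \<phi>])
    show "\<phi> (x, 0) = 0" for x using prim[of 0 x] by simp
    fix x :: 'p and t :: real assume t: "t \<in> {-1..1}"
    have pair: "continuous_on {-1..1} (\<lambda>s. (x, s))" by (intro continuous_intros)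
    have "continuous_on {-1..1} (\<lambda>s. ((x, s), \<phi> (x, s)))"
      by (intro continuous_intros continuous_on_compose2[OF continuous_on_apply_bcontfun[of UNIV \<phi>] pair]) auto
    from continuous_on_compose2[OF cont this]
    have "continuous_on {-1..1} (\<lambda>s. g (x, s) (\<phi> (x, s)))" by simp
    from primitive_has_vector_derivative[OF this t]
    show "((\<lambda>s. \<phi> (x, s)) has_vector_derivative g (x, t) (\<phi> (x, t))) (at t within {-1..1})"
      by (rule has_vector_derivative_transform[OF t, rotated]) (rule prim)
  qed simp
qed

text \<open>Near a zero \<open>z\<close> of \<open>f\<close> the increment of \<open>c\<close> is multiplied by a quantity of order \<open>norm (y - z)\<close>, so its
  mere continuity makes this term negligible.\<close>

lemma has_derivative_bilinear_vanishing:
  assumes B: "bounded_bilinear B" and c: "isCont c z" and f: "(f has_derivative f') (at z)" and f0: "f z = 0"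
  shows "((\<lambda>y. B (c y) (f y)) has_derivative (\<lambda>h. B (c z) (f' h))) (at z)"
  unfolding has_derivative_at_within
proof (intro conjI)
  interpret B: bounded_bilinear B by fact
  have f': "bounded_linear f'" using f by (rule has_derivative_bounded_linear)
  show "bounded_linear (\<lambda>h. B (c z) (f' h))"
    by (rule bounded_linear_compose[OF B.bounded_linear_right f'])
  obtain K where K: "\<And>h. norm (f' h) \<le> norm h * K" using bounded_linear.bounded[OF f'] by blast
  let ?q = "\<lambda>y. inverse (norm (y - z)) *\<^sub>R (f y - f' (y - z))"
  have "(?q \<longlongrightarrow> 0) (at z)"
    using f f0 by (simp add: has_derivative_at_within)
  then have 1: "((\<lambda>y. B (c y) (?q y)) \<longlongrightarrow> 0) (at z)"
    using B.tendsto[OF c[unfolded isCont_def], of ?q 0] by (simp add: B.zero_right)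
  obtain L where L: "0 < L" "\<And>a b. norm (B a b) \<le> norm a * norm b * L" using B.pos_bounded by blast
  have 2: "((\<lambda>y. inverse (norm (y - z)) *\<^sub>R B (c y - c z) (f' (y - z))) \<longlongrightarrow> 0) (at z)"
  proof (rule Lim_null_comparison)
    show "\<forall>\<^sub>F y in at z. norm (inverse (norm (y - z)) *\<^sub>R B (c y - c z) (f' (y - z))) \<le> norm (c y - c z) * \<bar>K\<bar> * L"
    proof (rule eventually_at_topological[THEN iffD2], intro exI[of _ UNIV] conjI ballI impI)
      fix y assume y: "y \<noteq> z"
      have "norm (B (c y - c z) (f' (y - z))) \<le> norm (c y - c z) * norm (f' (y - z)) * L" by (rule L)
      also have "\<dots> \<le> norm (c y - c z) * (norm (y - z) * \<bar>K\<bar>) * L"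
        using order_trans[OF K[of "y - z"] mult_left_mono[OF abs_ge_self norm_ge_zero]] L(1)
        by (intro mult_right_mono mult_left_mono) auto
      finally show "norm (inverse (norm (y - z)) *\<^sub>R B (c y - c z) (f' (y - z))) \<le> norm (c y - c z) * \<bar>K\<bar> * L"
        using y by (simp add: field_simps)
    qed auto
    have "((\<lambda>y. norm (c y - c z) * \<bar>K\<bar> * L) \<longlongrightarrow> norm (c z - c z) * \<bar>K\<bar> * L) (at z)"
      using c unfolding isCont_def by (intro tendsto_intros)
    then show "((\<lambda>y. norm (c y - c z) * \<bar>K\<bar> * L) \<longlongrightarrow> 0) (at z)" by simp
  qed
  have "((\<lambda>y. B (c y) (?q y) + inverse (norm (y - z)) *\<^sub>R B (c y - c z) (f' (y - z))) \<longlongrightarrow> 0) (at z)"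
    using tendsto_add[OF 1 2] by simp
  then show "((\<lambda>y. inverse (norm (y - z)) *\<^sub>R (B (c y) (f y) - B (c z) (f z) - B (c z) (f' (y - z)))) \<longlongrightarrow> 0) (at z)"
    by (rule Lim_transform_eventually)
      (auto simp: f0 B.zero_right B.scaleR_right B.diff_right B.diff_left scaleR_diff_right intro!: always_eventually)
qed

text \<open>By the resolvent identity \<open>G y - G z = - G y (F y - F z) G z\<close>, in which \<open>F y - F z\<close> vanishes at \<open>z\<close>.\<close>

lemma has_derivative_inverse_blinfun:
  fixes F :: "'z::real_normed_vector \<Rightarrow> 'a::real_normed_vector \<Rightarrow>\<^sub>L 'a"
  assumes "open S" "z \<in> S" and inv: "\<And>y. y \<in> S \<Longrightarrow> F y o\<^sub>L G y = id_blinfun" "\<And>y. y \<in> S \<Longrightarrow> G y o\<^sub>L F y = id_blinfun"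
    and G: "isCont G z" and F: "(F has_derivative F') (at z)"
  shows "(G has_derivative (\<lambda>h. - (G z o\<^sub>L (F' h o\<^sub>L G z)))) (at z)"
proof -
  have "((\<lambda>y. (F y - F z) o\<^sub>L G z) has_derivative (\<lambda>h. F' h o\<^sub>L G z)) (at z)"
    by (rule bounded_linear.has_derivative[OF bounded_bilinear.bounded_linear_left[OF bounded_bilinear_blinfun_compose]])
      (use F in \<open>auto intro!: derivative_eq_intros\<close>)
  from has_derivative_bilinear_vanishing[OF bounded_bilinear_blinfun_compose G this]
  have "((\<lambda>y. G z - (G y o\<^sub>L ((F y - F z) o\<^sub>L G z))) has_derivative (\<lambda>h. 0 - (G z o\<^sub>L (F' h o\<^sub>L G z)))) (at z)"
    by (intro has_derivative_diff has_derivative_const) simp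
  then have "(G has_derivative (\<lambda>h. 0 - (G z o\<^sub>L (F' h o\<^sub>L G z)))) (at z)"
  proof (rule has_derivative_transform_within_open[OF _ assms(1,2)])
    show "G z - (G y o\<^sub>L ((F y - F z) o\<^sub>L G z)) = G y" if "y \<in> S" for y
    proof (rule blinfun_eqI)
      fix v
      have "G y (F y (G z v)) = G z v" "F z (G z v) = v"
        using inv(2)[OF that] inv(1)[OF assms(2)]
        by (metis blinfun_apply_blinfun_compose id_blinfun.rep_eq)+
      then show "(G z - (G y o\<^sub>L ((F y - F z) o\<^sub>L G z))) v = G y v"
        by (simp add: blinfun.diff_left blinfun.diff_right)
    qed
  qed
  then show ?thesis by simp
qed

text \<open>Partial derivatives give a total derivative if one of them is jointly continuous; here it is the time
  derivative, the one that a differential equation provides.\<close>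

lemma has_derivative_space_time:
  fixes f :: "'a::real_normed_vector \<times> real \<Rightarrow> 'b::real_normed_vector"
  assumes "open X" "open Y" "convex Y" "(x, t) \<in> X \<times> Y"
    and fx: "((\<lambda>x. f (x, t)) has_derivative fx) (at x)"
    and ft: "\<And>x t. x \<in> X \<Longrightarrow> t \<in> Y \<Longrightarrow> ((\<lambda>t. f (x, t)) has_vector_derivative ft (x, t)) (at t)"
    and cont: "continuous_on (X \<times> Y) ft"
  shows "(f has_derivative (\<lambda>v. fx (fst v) + snd v *\<^sub>R ft (x, t))) (at (x, t))"
proof -
  have "((\<lambda>(x, t). f (x, t)) has_derivative (\<lambda>(h, \<tau>). fx h + blinfun_scaleR_left (ft (x, t)) \<tau>)) (at (x, t) within X \<times> Y)"
  proof (rule has_derivative_partialsI)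
    show "((\<lambda>x. f (x, t)) has_derivative fx) (at x within X)" using fx by (rule has_derivative_at_withinI)
    show "((\<lambda>t. f (x, t)) has_derivative blinfun_apply (blinfun_scaleR_left (ft (x, t)))) (at t within Y)"
      if "x \<in> X" "t \<in> Y" for x t
      using has_vector_derivative_at_within[OF ft[OF that], of Y]
      by (simp add: has_vector_derivative_def blinfun_scaleR_left.rep_eq)
    have "continuous_on (X \<times> Y) (\<lambda>z. blinfun_scaleR_left (ft z))"
      using cont by (rule bounded_linear.continuous_on[OF bounded_linear_blinfun_scaleR_left])
    then show "continuous (at (x, t) within X \<times> Y) (\<lambda>(x, t). blinfun_scaleR_left (ft (x, t)))"
      using assms(4) by (simp add: continuous_on_eq_continuous_within case_prod_unfold)
  qed (use assms in auto)
  then show ?thesis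
    using assms by (simp add: at_within_open[OF _ open_Times] case_prod_unfold)
qed

lemma has_vector_derivative_blinfun_compose:
  assumes "(f has_vector_derivative f') (at t within S)" "(g has_vector_derivative g') (at t within S)"
  shows "((\<lambda>t. f t o\<^sub>L g t) has_vector_derivative (f t o\<^sub>L g') + (f' o\<^sub>L g t)) (at t within S)"
  by (rule bounded_bilinear.has_vector_derivative[OF bounded_bilinear_blinfun_compose assms])

section \<open>Smoothness of the local flow\<close>

text \<open>A local flow \<open>\<phi>\<close> of \<open>u\<close> near \<open>p\<close> together with the fundamental solution \<open>F\<close> of the equation of
  variation along it and the solution \<open>G\<close> of the adjoint equation, which turns out to be the inverse
  of \<open>F\<close>. Time is restricted to \<open>(-1, 1)\<close> and \<open>u\<close> has a small derivative; this is no restriction, as a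
  field can be multiplied by a small constant. A priori the three maps are only continuous.\<close>

locale local_flow =
  fixes u :: "'a::euclidean_space \<Rightarrow> 'a" and W :: "'a set" and p :: 'a and \<rho> :: real
    and \<phi> :: "'a \<times> real \<Rightarrow> 'a" and F G :: "'a \<times> real \<Rightarrow> 'a \<Rightarrow>\<^sub>L 'a"
  assumes open_W: "open W" and smooth_u: "smooth_on W u" and cball_W: "cball p (2 * \<rho>) \<subseteq> W"
    and rho_pos: "0 < \<rho>"
    and small_derivative: "\<And>y. y \<in> cball p (2 * \<rho>) \<Longrightarrow> norm (deriv_blinfun u y) \<le> 1/4"
    and flow_in: "\<And>x t. x \<in> ball p \<rho> \<Longrightarrow> t \<in> {-1<..<1} \<Longrightarrow> \<phi> (x, t) \<in> ball p (2 * \<rho>)"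
    and flow_cont: "continuous_on (ball p \<rho> \<times> {-1<..<1}) \<phi>"
    and F_cont: "continuous_on (ball p \<rho> \<times> {-1<..<1}) F"
    and G_cont: "continuous_on (ball p \<rho> \<times> {-1<..<1}) G"
    and flow_0: "\<And>x. x \<in> ball p \<rho> \<Longrightarrow> \<phi> (x, 0) = x"
    and F_0: "\<And>x. x \<in> ball p \<rho> \<Longrightarrow> F (x, 0) = id_blinfun"
    and G_0: "\<And>x. x \<in> ball p \<rho> \<Longrightarrow> G (x, 0) = id_blinfun"
    and flow_ode: "\<And>x t. x \<in> ball p \<rho> \<Longrightarrow> t \<in> {-1<..<1} \<Longrightarrow>
      ((\<lambda>t. \<phi> (x, t)) has_vector_derivative u (\<phi> (x, t))) (at t)"
    and F_ode: "\<And>x t. x \<in> ball p \<rho> \<Longrightarrow> t \<in> {-1<..<1} \<Longrightarrow>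
      ((\<lambda>t. F (x, t)) has_vector_derivative deriv_blinfun u (\<phi> (x, t)) o\<^sub>L F (x, t)) (at t)"
    and G_ode: "\<And>x t. x \<in> ball p \<rho> \<Longrightarrow> t \<in> {-1<..<1} \<Longrightarrow>
      ((\<lambda>t. G (x, t)) has_vector_derivative - (G (x, t) o\<^sub>L deriv_blinfun u (\<phi> (x, t)))) (at t)"
begin

definition D where "D = ball p \<rho> \<times> {-1<..<1::real}"

definition A where "A z = deriv_blinfun u (\<phi> z)"

lemma open_D: "open D" unfolding D_def by (intro open_Times) auto

lemma Ck_u: "Ck_on k W u" using smooth_u by (simp add: smooth_on_def)

lemma u_has_derivative: "y \<in> W \<Longrightarrow> (u has_derivative deriv_blinfun u y) (at y)"
  using Ck_on_Suc_has_deriv_blinfun[OF Ck_u] .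

lemma flow_in_W: "z \<in> D \<Longrightarrow> \<phi> z \<in> W"
  using flow_in[of "fst z" "snd z"] cball_W ball_subset_cball[of p "2 * \<rho>"] by (auto simp: D_def)

lemma norm_A: "z \<in> D \<Longrightarrow> norm (A z) \<le> 1/4"
  unfolding A_def using flow_in[of "fst z" "snd z"] ball_subset_cball[of p "2 * \<rho>"]
  by (intro small_derivative) (auto simp: D_def)

lemma u_lipschitz:
  assumes "y \<in> cball p (2 * \<rho>)" "z \<in> cball p (2 * \<rho>)"
  shows "norm (u y - u z) \<le> 1/4 * norm (y - z)"
  by (rule lipschitz_of_deriv_blinfun_bound[OF Ck_u convex_cball cball_W small_derivative assms])

text \<open>Both products solve a linear equation with the constant solution \<open>id_blinfun\<close>; for \<open>G F\<close> the derivative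
  is even zero.\<close>

lemma F_G: "F z o\<^sub>L G z = id_blinfun" and G_F: "G z o\<^sub>L F z = id_blinfun" if z: "z \<in> D"
proof -
  obtain x t where zxt: "z = (x, t)" by fastforce
  then have x: "x \<in> ball p \<rho>" and t: "t \<in> {-1<..<1}" using z by (auto simp: D_def)
  have sub: "s \<in> {-1<..<1}" if "s \<in> {-\<bar>t\<bar>..\<bar>t\<bar>}" for s using that t by auto
  have id_id: "id_blinfun o\<^sub>L id_blinfun = (id_blinfun :: 'a \<Rightarrow>\<^sub>L 'a)"
    by (rule blinfun_eqI) simp
  have "norm ((F (x, t) o\<^sub>L G (x, t)) - id_blinfun) \<le> 2 * 0"
  proof (rule gronwall_unit_interval[where T = "\<bar>t\<bar>" and y = "\<lambda>s. (F (x, s) o\<^sub>L G (x, s)) - id_blinfun"])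
    let ?y' = "\<lambda>s. (A (x, s) o\<^sub>L ((F (x, s) o\<^sub>L G (x, s)) - id_blinfun)) - (((F (x, s) o\<^sub>L G (x, s)) - id_blinfun) o\<^sub>L A (x, s))"
    fix s assume s: "s \<in> {-\<bar>t\<bar>..\<bar>t\<bar>}"
    have "((\<lambda>s. (F (x, s) o\<^sub>L G (x, s)) - id_blinfun) has_vector_derivative
       (F (x, s) o\<^sub>L - (G (x, s) o\<^sub>L A (x, s))) + ((A (x, s) o\<^sub>L F (x, s)) o\<^sub>L G (x, s)) - 0) (at s)"
      unfolding A_def
      by (rule has_vector_derivative_diff[OF has_vector_derivative_blinfun_compose[OF
            F_ode[OF x sub[OF s]] G_ode[OF x sub[OF s]]] has_vector_derivative_const])
    moreover have "(F (x, s) o\<^sub>L - (G (x, s) o\<^sub>L A (x, s))) + ((A (x, s) o\<^sub>L F (x, s)) o\<^sub>L G (x, s)) - 0 = ?y' s"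
      by (rule blinfun_eqI) (simp add: blinfun.bilinear_simps id_blinfun.rep_eq)
    ultimately show "((\<lambda>s. (F (x, s) o\<^sub>L G (x, s)) - id_blinfun) has_vector_derivative ?y' s) (at s within {-\<bar>t\<bar>..\<bar>t\<bar>})"
      using has_vector_derivative_at_within by (simp only:)
    let ?M = "(F (x, s) o\<^sub>L G (x, s)) - id_blinfun"
    have nA: "norm (A (x, s)) \<le> 1/4" using norm_A x sub[OF s] by (simp add: D_def)
    have "norm (?y' s) \<le> norm (A (x, s) o\<^sub>L ?M) + norm (?M o\<^sub>L A (x, s))" by (rule norm_triangle_ineq4)
    also have "\<dots> \<le> norm (A (x, s)) * norm ?M + norm ?M * norm (A (x, s))"
      by (intro add_mono norm_blinfun_compose)
    also have "\<dots> \<le> 1/4 * norm ?M + norm ?M * (1/4)"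
      by (intro add_mono mult_mono nA) auto
    finally show "norm (?y' s) \<le> 1/2 * norm ?M + 0" by simp
  qed (use t F_0[OF x] G_0[OF x] id_id in auto)
  then show "F z o\<^sub>L G z = id_blinfun" by (simp add: zxt)
  have "norm ((G (x, t) o\<^sub>L F (x, t)) - id_blinfun) \<le> 0 * \<bar>t\<bar>"
  proof (rule norm_le_derivative_bound[where T = "\<bar>t\<bar>" and y = "\<lambda>s. (G (x, s) o\<^sub>L F (x, s)) - id_blinfun"])
    fix s assume s: "s \<in> {-\<bar>t\<bar>..\<bar>t\<bar>}"
    have "((\<lambda>s. (G (x, s) o\<^sub>L F (x, s)) - id_blinfun) has_vector_derivative
       (G (x, s) o\<^sub>L (A (x, s) o\<^sub>L F (x, s))) + (- (G (x, s) o\<^sub>L A (x, s)) o\<^sub>L F (x, s)) - 0) (at s)"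
      unfolding A_def
      by (rule has_vector_derivative_diff[OF has_vector_derivative_blinfun_compose[OF
            G_ode[OF x sub[OF s]] F_ode[OF x sub[OF s]]] has_vector_derivative_const])
    moreover have "(G (x, s) o\<^sub>L (A (x, s) o\<^sub>L F (x, s))) + (- (G (x, s) o\<^sub>L A (x, s)) o\<^sub>L F (x, s)) - 0 = 0"
      by (rule blinfun_eqI) (simp add: blinfun.bilinear_simps)
    ultimately show "((\<lambda>s. (G (x, s) o\<^sub>L F (x, s)) - id_blinfun) has_vector_derivative 0) (at s within {-\<bar>t\<bar>..\<bar>t\<bar>})"
      using has_vector_derivative_at_within by (simp only:)
  qed (use t F_0[OF x] G_0[OF x] id_id in auto)
  then show "G z o\<^sub>L F z = id_blinfun" by (simp add: zxt)
qed

lemma flow_difference_bound: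
  assumes "x \<in> ball p \<rho>" "x + h \<in> ball p \<rho>" "t \<in> {-1<..<1}"
  shows "norm (\<phi> (x + h, t) - \<phi> (x, t)) \<le> 2 * norm h"
proof -
  have "norm (\<phi> (x + h, t) - \<phi> (x, t) - h) \<le> 2 * (1/4 * norm h)"
  proof (rule gronwall_unit_interval[where T = "\<bar>t\<bar>" and y = "\<lambda>s. \<phi> (x + h, s) - \<phi> (x, s) - h"])
    fix s assume s: "s \<in> {-\<bar>t\<bar>..\<bar>t\<bar>}"
    then have s1: "s \<in> {-1<..<1}" using assms(3) by auto
    have "((\<lambda>s. \<phi> (x + h, s) - \<phi> (x, s) - h) has_vector_derivative u (\<phi> (x + h, s)) - u (\<phi> (x, s)) - 0) (at s)"
      by (intro has_vector_derivative_diff has_vector_derivative_const flow_ode assms s1)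
    then show "((\<lambda>s. \<phi> (x + h, s) - \<phi> (x, s) - h) has_vector_derivative u (\<phi> (x + h, s)) - u (\<phi> (x, s))) (at s within {-\<bar>t\<bar>..\<bar>t\<bar>})"
      by (simp add: has_vector_derivative_at_within)
    have "norm (u (\<phi> (x + h, s)) - u (\<phi> (x, s))) \<le> 1/4 * norm (\<phi> (x + h, s) - \<phi> (x, s))"
      using flow_in[OF assms(1) s1] flow_in[OF assms(2) s1] by (intro u_lipschitz) auto
    also have "\<dots> \<le> 1/4 * (norm (\<phi> (x + h, s) - \<phi> (x, s) - h) + norm h)"
      using norm_triangle_ineq[of "\<phi> (x + h, s) - \<phi> (x, s) - h" h] by simp
    also have "\<dots> \<le> 1/2 * norm (\<phi> (x + h, s) - \<phi> (x, s) - h) + 1/4 * norm h"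
      by (simp add: algebra_simps)
    finally show "norm (u (\<phi> (x + h, s)) - u (\<phi> (x, s))) \<le> 1/2 * norm (\<phi> (x + h, s) - \<phi> (x, s) - h) + 1/4 * norm h" .
  qed (use assms flow_0 in auto)
  then show ?thesis
    using norm_triangle_ineq[of "\<phi> (x + h, t) - \<phi> (x, t) - h" h] norm_ge_zero[of h] by (simp del: norm_ge_zero)
qed

text \<open>The remainder \<open>r = \<phi> (x + h, s) - \<phi> (x, s) - F (x, s) h\<close> satisfies \<open>r' = A r\<close> up to the first-order
  remainder of \<open>u\<close>, which is \<open>o(norm h)\<close> uniformly along the trajectory.\<close>

lemma flow_has_space_derivative:
  assumes x: "x \<in> ball p \<rho>" and t: "t \<in> {-1<..<1}"
  shows "((\<lambda>x. \<phi> (x, t)) has_derivative F (x, t)) (at x)"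
  unfolding has_derivative_at_alt
proof (intro conjI allI impI blinfun.bounded_linear_right)
  fix e :: real assume e: "0 < e"
  obtain d where d: "0 < d" "\<And>y z. y \<in> cball p (2 * \<rho>) \<Longrightarrow> z \<in> cball p (2 * \<rho>) \<Longrightarrow> norm (z - y) < d \<Longrightarrow>
      norm (u z - u y - deriv_blinfun u y (z - y)) \<le> e/4 * norm (z - y)"
    using uniformly_differentiable_on_compact[OF open_W Ck_u compact_cball convex_cball cball_W, of "e/4"] e
    by (metis divide_pos_pos zero_less_numeral)
  obtain r where r: "0 < r" "ball x r \<subseteq> ball p \<rho>" using openE[OF open_ball x] by blast
  have "norm (\<phi> (y, t) - \<phi> (x, t) - F (x, t) (y - x)) \<le> e * norm (y - x)" if y: "norm (y - x) < min r (d/2)" for y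
  proof -
    define h where "h = y - x"
    have yh: "y = x + h" by (simp add: h_def)
    have h: "norm h < d/2" "x + h \<in> ball p \<rho>" using y r by (auto simp: h_def dist_norm norm_minus_commute subset_iff)
    let ?y = "\<lambda>s. \<phi> (x + h, s) - \<phi> (x, s) - F (x, s) h"
    have "norm (?y t) \<le> 2 * (e/2 * norm h)"
    proof (rule gronwall_unit_interval[where T = "\<bar>t\<bar>" and y = ?y])
      fix s assume s: "s \<in> {-\<bar>t\<bar>..\<bar>t\<bar>}"
      then have s1: "s \<in> {-1<..<1}" using t by auto
      let ?y' = "u (\<phi> (x + h, s)) - u (\<phi> (x, s)) - A (x, s) (F (x, s) h)"
      have "((\<lambda>s. F (x, s) h) has_vector_derivative (A (x, s) o\<^sub>L F (x, s)) h) (at s)"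
        using bounded_linear.has_vector_derivative[OF blinfun.bounded_linear_left F_ode[OF x s1]] by (simp add: A_def)
      then have "(?y has_vector_derivative ?y') (at s)"
        by (intro has_vector_derivative_diff flow_ode x h(2) s1) simp
      then show "(?y has_vector_derivative ?y') (at s within {-\<bar>t\<bar>..\<bar>t\<bar>})"
        by (rule has_vector_derivative_at_within)
      let ?\<delta> = "\<phi> (x + h, s) - \<phi> (x, s)"
      have \<delta>: "norm ?\<delta> \<le> 2 * norm h" by (rule flow_difference_bound[OF x h(2) s1])
      have "norm (u (\<phi> (x + h, s)) - u (\<phi> (x, s)) - A (x, s) ?\<delta>) \<le> e/4 * norm ?\<delta>"
        unfolding A_def using flow_in[OF x s1] flow_in[OF h(2) s1] \<delta> h(1) by (intro d(2)) auto
      also have "\<dots> \<le> e/4 * (2 * norm h)" using \<delta> e by (intro mult_left_mono) auto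
      finally have 1: "norm (u (\<phi> (x + h, s)) - u (\<phi> (x, s)) - A (x, s) ?\<delta>) \<le> e/2 * norm h" by simp
      have "norm (A (x, s) (?y s)) \<le> norm (A (x, s)) * norm (?y s)" by (rule norm_blinfun)
      also have "\<dots> \<le> 1/4 * norm (?y s)"
        using norm_A[of "(x, s)"] x s1 by (intro mult_right_mono) (auto simp: D_def)
      also have "\<dots> \<le> 1/2 * norm (?y s)" by simp
      finally have 2: "norm (A (x, s) (?y s)) \<le> 1/2 * norm (?y s)" .
      have "?y' = (u (\<phi> (x + h, s)) - u (\<phi> (x, s)) - A (x, s) ?\<delta>) + A (x, s) (?y s)"
        by (simp add: blinfun.bilinear_simps)
      then have "norm ?y' \<le> norm (u (\<phi> (x + h, s)) - u (\<phi> (x, s)) - A (x, s) ?\<delta>) + norm (A (x, s) (?y s))"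
        by (metis norm_triangle_ineq)
      with 1 2 show "norm ?y' \<le> 1/2 * norm (?y s) + e/2 * norm h" by linarith
    qed (use t x h(2) flow_0 F_0 in \<open>auto simp: id_blinfun.rep_eq\<close>)
    then show ?thesis by (simp add: yh)
  qed
  then show "\<exists>d>0. \<forall>y. norm (y - x) < d \<longrightarrow> norm (\<phi> (y, t) - \<phi> (x, t) - F (x, t) (y - x)) \<le> e * norm (y - x)"
    using r(1) d(1) by (intro exI[of _ "min r (d/2)"]) auto
qed

text \<open>Differentiating \<open>F' = A F\<close> in the direction \<open>h\<close> formally yields \<open>R' = A R + (\<partial>\<^sub>h A) F\<close> with \<open>R = 0\<close> at
  time \<open>0\<close>, and variation of constants solves this equation by \<open>R = F \<integral> G (\<partial>\<^sub>h A) F\<close>. Thus \<open>R\<close> is the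
  candidate for the derivative of \<open>F\<close>, and it is an explicit expression in \<open>F\<close>, \<open>G\<close> and \<open>A\<close>.\<close>

definition Q where "Q h z = G z o\<^sub>L (frechet_derivative A (at z) (h, 0) o\<^sub>L F z)"

definition R where "R h z = F z o\<^sub>L primitive (\<lambda>s. Q h (fst z, s)) (snd z)"

lemma Q_continuous:
  assumes A: "Ck_on (Suc 0) D A"
  shows "continuous_on D (Q h)"
  unfolding Q_def
  using A F_cont G_cont by (intro continuous_intros) (auto simp: D_def)

lemma Q_continuous_time:
  assumes A: "Ck_on (Suc 0) D A" and x: "x \<in> ball p \<rho>" and T: "T < 1"
  shows "continuous_on {-T..T} (\<lambda>s. Q h (x, s))"
  by (rule continuous_on_compose2[OF Q_continuous[OF A]])
    (use x T in \<open>auto intro!: continuous_intros simp: D_def\<close>)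

lemma R_linear:
  assumes A: "Ck_on (Suc 0) D A" and z: "z \<in> D"
  shows "linear (\<lambda>h. R h z)"
proof -
  obtain x t where zxt: "z = (x, t)" by fastforce
  then have x: "x \<in> ball p \<rho>" and t: "t \<in> {-1<..<1}" using z by (auto simp: D_def)
  have lin: "linear (frechet_derivative A (at (x, s)))" if "s \<in> {-1<..<1}" for s
    using has_derivative_linear[OF Ck_on_Suc_has_derivative[OF A, of "(x, s)"]] x that by (simp add: D_def)
  have sub: "\<theta> * t \<in> {-1<..<1}" if "\<theta> \<in> {0..1}" for \<theta>
  proof -
    have "\<theta> * t \<in> {-\<bar>t\<bar>..\<bar>t\<bar>}" by (rule scale_mem_symmetric_interval[OF that]) auto
    then show ?thesis using t by auto
  qed
  have Q_add: "Q (h + k) (x, s) = Q h (x, s) + Q k (x, s)" if "s \<in> {-1<..<1}" for h k s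
    using linear_add[OF lin[OF that], of "(h, 0)" "(k, 0)"]
    by (intro blinfun_eqI) (simp add: Q_def blinfun.bilinear_simps)
  have Q_scale: "Q (c *\<^sub>R h) (x, s) = c *\<^sub>R Q h (x, s)" if "s \<in> {-1<..<1}" for c h s
    using linear_cmul[OF lin[OF that], of c "(h, 0)"]
    by (intro blinfun_eqI) (simp add: Q_def blinfun.bilinear_simps)
  have int: "(\<lambda>\<theta>. Q h (x, \<theta> * t)) integrable_on {0..1}" for h
    by (intro integrable_continuous_interval continuous_on_compose2[OF Q_continuous[OF A]])
      (use x sub in \<open>auto intro!: continuous_intros simp: D_def\<close>)
  have "integral {0..1} (\<lambda>\<theta>. Q (h + k) (x, \<theta> * t)) = integral {0..1} (\<lambda>\<theta>. Q h (x, \<theta> * t) + Q k (x, \<theta> * t))" for h k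
    by (intro integral_cong Q_add sub)
  then have 1: "integral {0..1} (\<lambda>\<theta>. Q (h + k) (x, \<theta> * t)) = integral {0..1} (\<lambda>\<theta>. Q h (x, \<theta> * t)) + integral {0..1} (\<lambda>\<theta>. Q k (x, \<theta> * t))" for h k
    using int by (simp add: integral_add)
  have "integral {0..1} (\<lambda>\<theta>. Q (c *\<^sub>R h) (x, \<theta> * t)) = integral {0..1} (\<lambda>\<theta>. c *\<^sub>R Q h (x, \<theta> * t))" for c h
    by (intro integral_cong Q_scale sub)
  then have 2: "integral {0..1} (\<lambda>\<theta>. Q (c *\<^sub>R h) (x, \<theta> * t)) = c *\<^sub>R integral {0..1} (\<lambda>\<theta>. Q h (x, \<theta> * t))" for c h
    by simp
  show ?thesis
    by (intro linearI blinfun_eqI)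
      (simp_all add: R_def zxt primitive_def 1 2 blinfun.bilinear_simps algebra_simps)
qed

lemma R_ode:
  assumes A: "Ck_on (Suc 0) D A" and x: "x \<in> ball p \<rho>" and T: "T < 1" and s: "s \<in> {-T..T}"
  shows "((\<lambda>s. R h (x, s)) has_vector_derivative
    (A (x, s) o\<^sub>L R h (x, s)) + (frechet_derivative A (at (x, s)) (h, 0) o\<^sub>L F (x, s))) (at s within {-T..T})"
proof -
  have s1: "s \<in> {-1<..<1}" using s T by auto
  have "((\<lambda>s. F (x, s) o\<^sub>L primitive (\<lambda>s. Q h (x, s)) s) has_vector_derivative
    (F (x, s) o\<^sub>L Q h (x, s)) + ((A (x, s) o\<^sub>L F (x, s)) o\<^sub>L primitive (\<lambda>s. Q h (x, s)) s)) (at s within {-T..T})"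
    unfolding A_def
    by (intro has_vector_derivative_blinfun_compose has_vector_derivative_at_within[OF F_ode[OF x s1]]
      primitive_has_vector_derivative[OF Q_continuous_time[OF A x T] s])
  moreover have "(F (x, s) o\<^sub>L Q h (x, s)) + ((A (x, s) o\<^sub>L F (x, s)) o\<^sub>L primitive (\<lambda>s. Q h (x, s)) s)
    = (A (x, s) o\<^sub>L R h (x, s)) + (frechet_derivative A (at (x, s)) (h, 0) o\<^sub>L F (x, s))"
  proof (rule blinfun_eqI)
    have FG: "F (x, s) (G (x, s) w) = w" for w
      using F_G[of "(x, s)"] x s1
      by (metis D_def blinfun_apply_blinfun_compose id_blinfun.rep_eq mem_Times_iff fst_conv snd_conv)
    show "((F (x, s) o\<^sub>L Q h (x, s)) + ((A (x, s) o\<^sub>L F (x, s)) o\<^sub>L primitive (\<lambda>s. Q h (x, s)) s)) w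
      = ((A (x, s) o\<^sub>L R h (x, s)) + (frechet_derivative A (at (x, s)) (h, 0) o\<^sub>L F (x, s))) w" for w
      by (simp add: Q_def R_def blinfun.bilinear_simps FG)
  qed
  ultimately show ?thesis by (simp add: R_def)
qed

text \<open>As for the flow, the remainder \<open>F (x + h) - F x - R h\<close> solves the equation of variation up to an error
  \<open>o(norm h)\<close>; the error now consists of the first-order remainder of \<open>A\<close> and of the product of the
  increments of \<open>A\<close> and \<open>F\<close>.\<close>

lemma F_has_space_derivative:
  assumes A: "Ck_on (Suc 0) D A" and x: "x \<in> ball p \<rho>" and t: "t \<in> {-1<..<1}"
  shows "((\<lambda>x. F (x, t)) has_derivative (\<lambda>h. R h (x, t))) (at x)"
  unfolding has_derivative_at_alt
proof (intro conjI allI impI)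
  show "bounded_linear (\<lambda>h. R h (x, t))"
    using R_linear[OF A, of "(x, t)"] x t by (simp add: linear_conv_bounded_linear D_def)
  fix e :: real assume e: "0 < e"
  define T where "T = \<bar>t\<bar>"
  have T: "T < 1" "t \<in> {-T..T}" using t by (auto simp: T_def)
  obtain r where r: "0 < r" "cball x r \<subseteq> ball p \<rho>" using open_contains_cball[of "ball p \<rho>"] x open_ball by blast
  define K where "K = cball x r \<times> {-T..T}"
  have K: "compact K" "convex K" "K \<subseteq> D"
    using r T(1) by (auto simp: K_def D_def intro!: compact_Times convex_Times)
  obtain C where C: "\<And>z. z \<in> K \<Longrightarrow> norm (deriv_blinfun A z) \<le> C"
    using compact_imp_bounded[OF compact_continuous_image[OF continuous_on_subset[OF
          deriv_blinfun_continuous_on[OF open_D A] K(3)] K(1)]]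
    by (auto simp: bounded_iff)
  have F_contK: "continuous_on K F" using F_cont K(3) by (auto simp: D_def intro: continuous_on_subset)
  obtain B where B: "\<And>z. z \<in> K \<Longrightarrow> norm (F z) \<le> B"
    using compact_imp_bounded[OF compact_continuous_image[OF F_contK K(1)]] by (auto simp: bounded_iff)
  have xK: "(x, s) \<in> K" if "s \<in> {-T..T}" for s using that r by (auto simp: K_def)
  have C0: "0 \<le> C" and B0: "0 \<le> B"
    using order_trans[OF norm_ge_zero C[OF xK[OF T(2)]]] order_trans[OF norm_ge_zero B[OF xK[OF T(2)]]] by auto
  \<comment> \<open>chosen so that \<open>e1 B\<close> and \<open>(e1 + C) e2\<close>, which bound the two parts of the error relative to \<open>norm h\<close>, are at most \<open>e/4\<close>\<close>
  define e1 where "e1 = min 1 (e / (4 * (B + 1)))"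
  define e2 where "e2 = e / (4 * (C + 1))"
  have e12: "0 < e1" "0 < e2" using e B0 C0 by (auto simp: e1_def e2_def)
  have "e1 * B \<le> e / (4 * (B + 1)) * B" using B0 by (intro mult_right_mono) (auto simp: e1_def)
  also have "\<dots> \<le> e/4" using B0 e by (simp add: field_simps)
  finally have e1B: "e1 * B \<le> e/4" .
  have "(e1 + C) * e2 \<le> (1 + C) * e2" using e12 by (intro mult_right_mono) (auto simp: e1_def)
  also have "\<dots> = e/4" using C0 by (simp add: e2_def field_simps)
  finally have e2C: "(e1 + C) * e2 \<le> e/4" .
  obtain d1 where d1: "0 < d1" "\<And>y z. y \<in> K \<Longrightarrow> z \<in> K \<Longrightarrow> norm (z - y) < d1 \<Longrightarrow>
      norm (A z - A y - deriv_blinfun A y (z - y)) \<le> e1 * norm (z - y)"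
    using uniformly_differentiable_on_compact[OF open_D A K e12(1)] by metis
  obtain d2 where d2: "0 < d2" "\<And>y z. y \<in> K \<Longrightarrow> z \<in> K \<Longrightarrow> dist z y < d2 \<Longrightarrow> dist (F z) (F y) < e2"
    using compact_uniformly_continuous[OF F_contK K(1)] e12(2) unfolding uniformly_continuous_on_def by metis
  have "norm (F (y, t) - F (x, t) - R (y - x) (x, t)) \<le> e * norm (y - x)"
    if y: "norm (y - x) < min r (min d1 d2)" for y
  proof -
    define h where "h = y - x"
    have yh: "y = x + h" by (simp add: h_def)
    have h: "norm h < d1" "norm h < d2" "norm h < r" using y by (auto simp: h_def)
    then have "x + h \<in> cball x r" by (simp add: dist_norm)
    then have xh: "x + h \<in> ball p \<rho>" and xhK: "(x + h, s) \<in> K" if "s \<in> {-T..T}" for s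
      using r that by (auto simp: K_def)
    let ?y = "\<lambda>s. F (x + h, s) - F (x, s) - R h (x, s)"
    have "norm (?y t) \<le> 2 * (e/2 * norm h)"
    proof (rule gronwall_unit_interval[where T = T and y = ?y])
      fix s assume s: "s \<in> {-T..T}"
      then have s1: "s \<in> {-1<..<1}" using T by auto
      let ?A' = "frechet_derivative A (at (x, s)) (h, 0)"
      let ?y' = "(A (x + h, s) o\<^sub>L F (x + h, s)) - (A (x, s) o\<^sub>L F (x, s)) - ((A (x, s) o\<^sub>L R h (x, s)) + (?A' o\<^sub>L F (x, s)))"
      show "(?y has_vector_derivative ?y') (at s within {-T..T})"
        unfolding A_def
        by (intro has_vector_derivative_diff has_vector_derivative_at_within[OF F_ode] x xh[OF s] s1
            R_ode[OF A x T(1) s, unfolded A_def])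
      have xs: "(x, s) \<in> D" using x s1 by (simp add: D_def)
      have dA: "deriv_blinfun A (x, s) (h, 0) = ?A'"
        using deriv_blinfun_eq[OF Ck_on_Suc_has_derivative[OF A xs]] by simp
      let ?\<Delta>A = "A (x + h, s) - A (x, s)" and ?\<Delta>F = "F (x + h, s) - F (x, s)"
      have "norm (?\<Delta>A - deriv_blinfun A (x, s) ((x + h, s) - (x, s))) \<le> e1 * norm ((x + h, s) - (x, s))"
        by (rule d1(2)[OF xK[OF s] xhK[OF s]]) (use h(1) in simp)
      then have 1: "norm (?\<Delta>A - ?A') \<le> e1 * norm h" by (simp add: dA)
      have "norm ?A' \<le> norm (deriv_blinfun A (x, s)) * norm (h, 0::real)"
        unfolding dA[symmetric] by (rule norm_blinfun)
      also have "\<dots> \<le> C * norm h" using C[OF xK[OF s]] by (simp add: mult_right_mono)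
      finally have 2: "norm ?A' \<le> C * norm h" .
      have "norm ?\<Delta>A \<le> norm (?\<Delta>A - ?A') + norm ?A'" using norm_triangle_ineq[of "?\<Delta>A - ?A'" ?A'] by simp
      with 1 2 have 3: "norm ?\<Delta>A \<le> (e1 + C) * norm h" by (simp add: distrib_right)
      have 4: "norm ?\<Delta>F \<le> e2"
        using d2(2)[OF xK[OF s] xhK[OF s]] h(2) by (simp add: dist_norm)
      have "norm (A (x, s) o\<^sub>L ?y s) \<le> norm (A (x, s)) * norm (?y s)" by (rule norm_blinfun_compose)
      also have "\<dots> \<le> 1/4 * norm (?y s)" by (intro mult_right_mono norm_A xs) auto
      also have "\<dots> \<le> 1/2 * norm (?y s)" by simp
      finally have 5: "norm (A (x, s) o\<^sub>L ?y s) \<le> 1/2 * norm (?y s)" .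
      have "norm ((?\<Delta>A - ?A') o\<^sub>L F (x, s)) \<le> norm (?\<Delta>A - ?A') * norm (F (x, s))" by (rule norm_blinfun_compose)
      also have "\<dots> \<le> (e1 * norm h) * B" using 1 B[OF xK[OF s]] e12 by (intro mult_mono) auto
      also have "\<dots> \<le> e/4 * norm h" using mult_right_mono[OF e1B norm_ge_zero[of h]] by (simp add: mult_ac)
      finally have 6: "norm ((?\<Delta>A - ?A') o\<^sub>L F (x, s)) \<le> e/4 * norm h" .
      have "norm (?\<Delta>A o\<^sub>L ?\<Delta>F) \<le> norm ?\<Delta>A * norm ?\<Delta>F" by (rule norm_blinfun_compose)
      also have "\<dots> \<le> ((e1 + C) * norm h) * e2" using 3 4 e12 C0 by (intro mult_mono) auto
      also have "\<dots> \<le> e/4 * norm h" using mult_right_mono[OF e2C norm_ge_zero[of h]] by (simp add: mult_ac)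
      finally have 7: "norm (?\<Delta>A o\<^sub>L ?\<Delta>F) \<le> e/4 * norm h" .
      have "?y' = (A (x, s) o\<^sub>L ?y s) + ((?\<Delta>A - ?A') o\<^sub>L F (x, s)) + (?\<Delta>A o\<^sub>L ?\<Delta>F)"
        by (rule blinfun_eqI) (simp add: blinfun.bilinear_simps)
      then have "norm ?y' \<le> norm (A (x, s) o\<^sub>L ?y s) + norm ((?\<Delta>A - ?A') o\<^sub>L F (x, s)) + norm (?\<Delta>A o\<^sub>L ?\<Delta>F)"
        using norm_triangle_ineq norm_triangle_mono by (smt (verit))
      with 5 6 7 show "norm ?y' \<le> 1/2 * norm (?y s) + e/2 * norm h" by linarith
    next
      have "0 \<in> {-T..T}" by (simp add: T_def)
      then show "?y 0 = 0" using F_0[OF x] F_0[OF xh[of 0]] by (simp add: R_def)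
    qed (use T in auto)
    then show ?thesis by (simp add: yh)
  qed
  then show "\<exists>d>0. \<forall>y. norm (y - x) < d \<longrightarrow> norm (F (y, t) - F (x, t) - R (y - x) (x, t)) \<le> e * norm (y - x)"
    using r(1) d1(1) d2(1) by (intro exI[of _ "min r (min d1 d2)"]) auto
qed

lemmas compose_blinfun = Ck_on_bilinear[OF open_D bounded_bilinear_blinfun_compose]

lemma Ck_on_scaleR_const:
  assumes "Ck_on k D f"
  shows "Ck_on k D (\<lambda>z. \<tau> *\<^sub>R f z)"
  by (rule Ck_on_bounded_linear[OF open_D bounded_linear_scaleR_right assms])

lemma u_flow_Ck: "Ck_on k D \<phi> \<Longrightarrow> Ck_on k D (\<lambda>z. u (\<phi> z))"
  by (rule Ck_on_compose[OF open_D Ck_u _ flow_in_W])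

lemma A_Ck:
  assumes "Ck_on k D \<phi>"
  shows "Ck_on k D A"
proof -
  have "Ck_on k D (\<lambda>z. deriv_blinfun u (\<phi> z))"
    by (rule Ck_on_compose[OF open_D Ck_on_deriv_blinfun[OF open_W Ck_u] assms flow_in_W])
  then show ?thesis by (simp add: A_def[abs_def])
qed

text \<open>The derivative of the flow is \<open>(h, \<tau>) \<mapsto> F h + \<tau> u(\<phi>)\<close>, of the same class as \<open>F\<close> and \<open>\<phi>\<close>.\<close>

lemma flow_Ck_Suc:
  assumes \<phi>: "Ck_on k D \<phi>" and F: "Ck_on k D F"
  shows "Ck_on (Suc k) D \<phi>"
proof (rule Ck_on_SucI[OF open_D])
  fix z assume z: "z \<in> D"
  then have xt: "(fst z, snd z) \<in> ball p \<rho> \<times> {-1<..<1}" by (simp add: D_def)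
  have "continuous_on D (\<lambda>z. u (\<phi> z))" by (rule Ck_on_continuous[OF u_flow_Ck[OF \<phi>]])
  then have "(\<phi> has_derivative (\<lambda>v. F (fst z, snd z) (fst v) + snd v *\<^sub>R u (\<phi> (fst z, snd z)))) (at (fst z, snd z))"
    using xt flow_has_space_derivative flow_ode
    by (intro has_derivative_space_time[OF open_ball open_greaterThanLessThan convex_real_interval(8) xt])
      (auto simp: D_def)
  then show "(\<phi> has_derivative (\<lambda>v. F z (fst v) + snd v *\<^sub>R u (\<phi> z))) (at z)" by simp
next
  show "Ck_on k D (\<lambda>z. F z (fst v) + snd v *\<^sub>R u (\<phi> z))" for v
    by (intro Ck_on_add[OF open_D] Ck_on_scaleR_const u_flow_Ck \<phi>
        Ck_on_bounded_linear[OF open_D blinfun.bounded_linear_left] F)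
qed

lemma R_Ck:
  assumes A: "Ck_on (Suc k) D A" and F: "Ck_on k D F" and G: "Ck_on k D G"
  shows "Ck_on k D (R h)"
proof -
  have Q: "Ck_on k D (Q h)"
    unfolding Q_def using A by (intro compose_blinfun F G) simp
  \<comment> \<open>in the rescaled integral the time \<open>s\<close> becomes \<open>\<theta> t\<close>; \<open>m\<close> is this substitution, defined on the open set where it stays in \<open>D\<close>\<close>
  define m :: "('a \<times> real) \<times> real \<Rightarrow> 'a \<times> real" where "m r = (fst (fst r), snd r * snd (fst r))" for r
  define S :: "(('a \<times> real) \<times> real) set" where "S = m -` D"
  have "continuous_on UNIV m" unfolding m_def by (intro continuous_intros)
  then have S: "open S" unfolding S_def using open_D open_vimage by blast
  have "Ck_on k S m"
    unfolding m_def
    by (intro Ck_on_Pair[OF S] Ck_on_linear[OF S] Ck_on_bilinear[OF S bounded_bilinear_mult]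
        bounded_linear_intros)
  then have "Ck_on k S (\<lambda>r. Q h (m r))"
    by (rule Ck_on_compose[OF S Q]) (simp add: S_def)
  moreover have "D \<times> {0..1} \<subseteq> S"
  proof
    fix r :: "('a \<times> real) \<times> real" assume r: "r \<in> D \<times> {0..1}"
    have "snd r * snd (fst r) \<in> {-\<bar>snd (fst r)\<bar>..\<bar>snd (fst r)\<bar>}"
      by (rule scale_mem_symmetric_interval) (use r in auto)
    with r show "r \<in> S" by (auto simp: S_def m_def D_def)
  qed
  ultimately have int: "Ck_on k D (\<lambda>z. integral {0..1} (\<lambda>\<theta>. Q h (m (z, \<theta>))))"
    by (intro Ck_on_param_integral[OF S open_D])
  have "Ck_on k D (\<lambda>z. F z o\<^sub>L (snd z *\<^sub>R integral {0..1} (\<lambda>\<theta>. Q h (m (z, \<theta>)))))"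
    by (intro compose_blinfun F int Ck_on_bilinear[OF open_D bounded_bilinear_scaleR]
        Ck_on_linear[OF open_D bounded_linear_snd])
  then show ?thesis by (simp add: R_def[abs_def] primitive_def m_def)
qed

text \<open>The formula for \<open>R\<close> contains one derivative of \<open>A\<close>, but \<open>A\<close> is as smooth as the flow and hence one
  class better than \<open>F\<close>: this is where the induction gains an order.\<close>

lemma F_Ck_Suc:
  assumes \<phi>: "Ck_on (Suc k) D \<phi>" and F: "Ck_on k D F" and G: "Ck_on k D G"
  shows "Ck_on (Suc k) D F"
proof (rule Ck_on_SucI[OF open_D])
  have A: "Ck_on (Suc k) D A" by (rule A_Ck[OF \<phi>])
  have A1: "Ck_on (Suc 0) D A" by (rule Ck_on_le[OF A]) simp
  have AF: "Ck_on k D (\<lambda>z. A z o\<^sub>L F z)" by (rule compose_blinfun[OF Ck_on_SucD[OF A] F])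
  show "(F has_derivative (\<lambda>v. R (fst v) z + snd v *\<^sub>R (A z o\<^sub>L F z))) (at z)" if z: "z \<in> D" for z
  proof -
    have xt: "(fst z, snd z) \<in> ball p \<rho> \<times> {-1<..<1}" using z by (simp add: D_def)
    have "(F has_derivative (\<lambda>v. R (fst v) (fst z, snd z) + snd v *\<^sub>R (A (fst z, snd z) o\<^sub>L F (fst z, snd z)))) (at (fst z, snd z))"
      using xt F_has_space_derivative[OF A1] F_ode Ck_on_continuous[OF AF]
      by (intro has_derivative_space_time[OF open_ball open_greaterThanLessThan convex_real_interval(8) xt])
        (auto simp: D_def A_def)
    then show ?thesis by simp
  qed
  show "Ck_on k D (\<lambda>z. R (fst v) z + snd v *\<^sub>R (A z o\<^sub>L F z))" for v
    by (intro Ck_on_add[OF open_D] Ck_on_scaleR_const AF R_Ck A F G)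
qed

lemma G_Ck_Suc:
  assumes F: "Ck_on (Suc k) D F" and G: "Ck_on k D G"
  shows "Ck_on (Suc k) D G"
proof (rule Ck_on_SucI[OF open_D])
  show "(G has_derivative (\<lambda>v. - (G z o\<^sub>L (frechet_derivative F (at z) v o\<^sub>L G z)))) (at z)" if z: "z \<in> D" for z
    using Ck_on_continuous[OF G] open_D z
    by (intro has_derivative_inverse_blinfun[OF open_D z F_G G_F _ Ck_on_Suc_has_derivative[OF F z]])
      (auto simp: continuous_on_eq_continuous_at)
  show "Ck_on k D (\<lambda>z. - (G z o\<^sub>L (frechet_derivative F (at z) v o\<^sub>L G z)))" for v
  proof -
    have "Ck_on k D (\<lambda>z. frechet_derivative F (at z) v)" using F unfolding Ck_on.simps(2) by blast
    then show ?thesis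
      by (intro Ck_on_bounded_linear[OF open_D bounded_linear_minus[OF bounded_linear_ident]] compose_blinfun G)
  qed
qed

text \<open>The maps \<open>\<phi>\<close>, \<open>F\<close>, \<open>G\<close> bootstrap one another, the flow being one class ahead.\<close>

theorem flow_smooth: "smooth_on D \<phi>"
proof -
  have "Ck_on (Suc k) D \<phi> \<and> Ck_on k D F \<and> Ck_on k D G" for k
  proof (induction k)
    case 0
    have "Ck_on 0 D \<phi>" "Ck_on 0 D F" "Ck_on 0 D G" using flow_cont F_cont G_cont by (simp_all add: D_def)
    then show ?case using flow_Ck_Suc by blast
  next
    case (Suc k)
    then show ?case using F_Ck_Suc G_Ck_Suc flow_Ck_Suc by blast
  qed
  then show ?thesis unfolding smooth_on_def using Ck_on_SucD by blast
qed

text \<open>The flow transports the field into itself: both sides solve the equation of variation and agree at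
  time \<open>0\<close>. This substitutes for the group property of the flow.\<close>

lemma F_u:
  assumes x: "x \<in> ball p \<rho>" and t: "t \<in> {-1<..<1}"
  shows "F (x, t) (u x) = u (\<phi> (x, t))"
proof -
  let ?y = "\<lambda>s. F (x, s) (u x) - u (\<phi> (x, s))"
  have "norm (?y t) \<le> 2 * 0"
  proof (rule gronwall_unit_interval[where T = "\<bar>t\<bar>" and y = ?y])
    fix s assume s: "s \<in> {-\<bar>t\<bar>..\<bar>t\<bar>}"
    then have s1: "s \<in> {-1<..<1}" using t by auto
    then have xs: "(x, s) \<in> D" using x by (simp add: D_def)
    have "((\<lambda>s. F (x, s) (u x)) has_vector_derivative (A (x, s) o\<^sub>L F (x, s)) (u x)) (at s)"
      using bounded_linear.has_vector_derivative[OF blinfun.bounded_linear_left F_ode[OF x s1]] by (simp add: A_def)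
    moreover have "((\<lambda>s. u (\<phi> (x, s))) has_vector_derivative A (x, s) (u (\<phi> (x, s)))) (at s)"
      using has_derivative_compose[OF flow_ode[OF x s1, unfolded has_vector_derivative_def] u_has_derivative[OF flow_in_W[OF xs]]]
      by (simp add: has_vector_derivative_def A_def blinfun.scaleR_right)
    ultimately have "(?y has_vector_derivative A (x, s) (?y s)) (at s)"
      using has_vector_derivative_diff by (fastforce simp: blinfun.diff_right)
    then show "(?y has_vector_derivative A (x, s) (?y s)) (at s within {-\<bar>t\<bar>..\<bar>t\<bar>})"
      by (rule has_vector_derivative_at_within)
    have "norm (A (x, s) (?y s)) \<le> norm (A (x, s)) * norm (?y s)" by (rule norm_blinfun)
    also have "\<dots> \<le> 1/2 * norm (?y s)"
      using norm_A[OF xs] by (intro mult_right_mono) auto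
    finally show "norm (A (x, s) (?y s)) \<le> 1/2 * norm (?y s) + 0" by simp
  qed (use t x flow_0 F_0 in \<open>auto simp: id_blinfun.rep_eq\<close>)
  then show ?thesis by simp
qed

lemma flow_has_derivative:
  assumes x: "x \<in> ball p \<rho>" and t: "t \<in> {-1<..<1}"
  shows "(\<phi> has_derivative (\<lambda>v. F (x, t) (fst v) + snd v *\<^sub>R u (\<phi> (x, t)))) (at (x, t))"
  using x t flow_has_space_derivative flow_ode Ck_on_continuous[OF u_flow_Ck[of 0]] flow_cont
  by (intro has_derivative_space_time[OF open_ball open_greaterThanLessThan convex_real_interval(8)])
    (auto simp: D_def)

end

section \<open>Existence of the local flow\<close>

text \<open>To have globally defined, bounded Lipschitz right-hand sides, \<open>u\<close> and its derivative are composed with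
  the nearest-point projection \<open>\<pi>\<close> onto the closed ball. Since \<open>u\<close> is bounded by \<open>\<rho>\<close>, trajectories that
  start within \<open>\<rho>\<close> of \<open>p\<close> stay where \<open>\<pi>\<close> is the identity.\<close>

theorem local_flow_exists:
  fixes u :: "'a::euclidean_space \<Rightarrow> 'a"
  assumes W: "open W" and u: "smooth_on W u" and K: "cball p (2 * \<rho>) \<subseteq> W" and \<rho>: "0 < \<rho>"
    and u_bound: "\<And>y. y \<in> cball p (2 * \<rho>) \<Longrightarrow> norm (u y) \<le> \<rho>"
    and du_bound: "\<And>y. y \<in> cball p (2 * \<rho>) \<Longrightarrow> norm (deriv_blinfun u y) \<le> 1/4"
  obtains \<phi> F G where "local_flow u W p \<rho> \<phi> F G"
proof -
  let ?K = "cball p (2 * \<rho>)"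
  define \<pi> where "\<pi> = closest_point ?K"
  have K_ne: "?K \<noteq> {}" using \<rho> by simp
  have \<pi>_in: "\<pi> y \<in> ?K" for y unfolding \<pi>_def using K_ne by (intro closest_point_in_set) auto
  have \<pi>_id: "\<pi> y = y" if "y \<in> ?K" for y unfolding \<pi>_def using that by (rule closest_point_self)
  have \<pi>_lip: "norm (\<pi> y - \<pi> z) \<le> norm (y - z)" for y z
    unfolding \<pi>_def dist_norm[symmetric] using K_ne by (intro closest_point_lipschitz) auto
  have \<pi>_cont: "continuous_on UNIV \<pi>" unfolding \<pi>_def using K_ne by (intro continuous_on_closest_point) auto
  have Ck_u: "Ck_on k W u" for k using u by (simp add: smooth_on_def)
  have u_lip: "norm (u y - u z) \<le> 1/4 * norm (y - z)" if "y \<in> ?K" "z \<in> ?K" for y z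
    by (rule lipschitz_of_deriv_blinfun_bound[OF Ck_u convex_cball K du_bound that])
  have u\<pi>_cont: "continuous_on UNIV (\<lambda>y. u (\<pi> y))"
    by (rule continuous_on_compose2[OF Ck_on_continuous[OF Ck_u] \<pi>_cont]) (use \<pi>_in K in auto)
  have du\<pi>_cont: "continuous_on UNIV (\<lambda>y. deriv_blinfun u (\<pi> y))"
    by (rule continuous_on_compose2[OF deriv_blinfun_continuous_on[OF W Ck_u] \<pi>_cont]) (use \<pi>_in K in auto)
  obtain \<psi> where \<psi>: "continuous_on UNIV \<psi>" "\<And>x. \<psi> (x, 0) = 0"
    "\<And>x t. t \<in> {-1..1} \<Longrightarrow> ((\<lambda>s. \<psi> (x, s)) has_vector_derivative u (\<pi> (x + \<psi> (x, t)))) (at t within {-1..1})"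
  proof (rule ode_solution_continuous_in_parameter[of "\<lambda>q y. u (\<pi> (fst q + y))" \<rho>])
    show "continuous_on UNIV (\<lambda>q :: ('a \<times> real) \<times> 'a. u (\<pi> (fst (fst q) + snd q)))"
      by (rule continuous_on_compose2[OF u\<pi>_cont]) (auto intro!: continuous_intros)
    show "norm (u (\<pi> (fst q + y)) - u (\<pi> (fst q + z))) \<le> 1/2 * norm (y - z)" for q :: "'a \<times> real" and y z
      using u_lip[OF \<pi>_in \<pi>_in, of "fst q + y" "fst q + z"] \<pi>_lip[of "fst q + y" "fst q + z"]
        norm_ge_zero[of "y - z"] by (simp del: norm_ge_zero add: algebra_simps)
    show "norm (u (\<pi> (fst q + 0))) \<le> \<rho>" for q :: "'a \<times> real" using u_bound[OF \<pi>_in] .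
  qed (rule that, assumption, assumption, simp)
  \<comment> \<open>\<open>\<psi>\<close> is the displacement; unlike \<open>\<phi>\<close> it is bounded, as is required of the solutions produced by the contraction, and \<open>F0\<close>, \<open>G0\<close> play the same part below\<close>
  define \<phi> where "\<phi> z = fst z + \<psi> z" for z
  have \<phi>_cont: "continuous_on UNIV \<phi>" unfolding \<phi>_def using \<psi>(1) by (intro continuous_intros)
  define A where "A z = deriv_blinfun u (\<pi> (\<phi> z))" for z
  have A_cont: "continuous_on UNIV A"
    unfolding A_def by (rule continuous_on_compose2[OF du\<pi>_cont \<phi>_cont]) auto
  have A_bound: "norm (A z) \<le> 1/4" for z unfolding A_def by (rule du_bound[OF \<pi>_in])
  have A_mult: "norm (A z o\<^sub>L M) \<le> 1/2 * norm M" "norm (M o\<^sub>L A z) \<le> 1/2 * norm M" for z and M :: "'a \<Rightarrow>\<^sub>L 'a"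
    using norm_blinfun_compose[of "A z" M] norm_blinfun_compose[of M "A z"]
      mult_right_mono[OF A_bound[of z] norm_ge_zero[of M]] norm_ge_zero[of M]
    by (auto simp: mult.commute simp del: norm_ge_zero)
  have id_compose: "A z o\<^sub>L (id_blinfun + M) = A z + (A z o\<^sub>L M)" "(id_blinfun + M) o\<^sub>L A z = A z + (M o\<^sub>L A z)" for z M
    by (auto intro!: blinfun_eqI simp: blinfun.bilinear_simps)
  obtain F0 where F0: "continuous_on UNIV F0" "\<And>x. F0 (x, 0) = 0"
    "\<And>x t. t \<in> {-1..1} \<Longrightarrow> ((\<lambda>s. F0 (x, s)) has_vector_derivative A (x, t) o\<^sub>L (id_blinfun + F0 (x, t))) (at t within {-1..1})"
  proof (rule ode_solution_continuous_in_parameter[of "\<lambda>q M. A q o\<^sub>L (id_blinfun + M)" "1/4"])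
    show "continuous_on UNIV (\<lambda>q :: ('a \<times> real) \<times> ('a \<Rightarrow>\<^sub>L 'a). A (fst q) o\<^sub>L (id_blinfun + snd q))"
      by (intro continuous_intros continuous_on_compose2[OF A_cont]) auto
    show "norm ((A q o\<^sub>L (id_blinfun + M)) - (A q o\<^sub>L (id_blinfun + N))) \<le> 1/2 * norm (M - N)" for q M N
      using A_mult(1)[of q "M - N"]
      by (simp add: id_compose bounded_bilinear.diff_right[OF bounded_bilinear_blinfun_compose])
    show "norm (A q o\<^sub>L (id_blinfun + 0)) \<le> 1/4" for q
      unfolding id_compose using A_bound by (simp add: bounded_bilinear.zero_right[OF bounded_bilinear_blinfun_compose])
  qed (rule that, assumption, assumption, simp)
  obtain G0 where G0: "continuous_on UNIV G0" "\<And>x. G0 (x, 0) = 0"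
    "\<And>x t. t \<in> {-1..1} \<Longrightarrow> ((\<lambda>s. G0 (x, s)) has_vector_derivative - ((id_blinfun + G0 (x, t)) o\<^sub>L A (x, t))) (at t within {-1..1})"
  proof (rule ode_solution_continuous_in_parameter[of "\<lambda>q M. - ((id_blinfun + M) o\<^sub>L A q)" "1/4"])
    show "continuous_on UNIV (\<lambda>q :: ('a \<times> real) \<times> ('a \<Rightarrow>\<^sub>L 'a). - ((id_blinfun + snd q) o\<^sub>L A (fst q)))"
      by (intro continuous_intros continuous_on_compose2[OF A_cont]) auto
    show "norm (- ((id_blinfun + M) o\<^sub>L A q) - - ((id_blinfun + N) o\<^sub>L A q)) \<le> 1/2 * norm (M - N)" for q M N
      using A_mult(2)[of "M - N" q]
      by (simp add: id_compose bounded_bilinear.diff_left[OF bounded_bilinear_blinfun_compose] norm_minus_commute)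
    show "norm (- ((id_blinfun + 0) o\<^sub>L A q)) \<le> 1/4" for q
      unfolding id_compose using A_bound by (simp add: bounded_bilinear.zero_left[OF bounded_bilinear_blinfun_compose])
  qed (rule that, assumption, assumption, simp)
  have interior: "at t within {-1..1} = at t" if "t \<in> {-1<..<1}" for t :: real
    using that by (intro at_within_interior) auto
  have \<phi>_in: "\<phi> (x, t) \<in> ball p (2 * \<rho>)" if x: "x \<in> ball p \<rho>" and t: "t \<in> {-1<..<1}" for x t
  proof -
    have "norm (\<psi> (x, t)) \<le> \<rho> * \<bar>t\<bar>"
      by (rule norm_le_derivative_bound[where T = 1, OF \<psi>(3)]) (use \<psi>(2) u_bound[OF \<pi>_in] t in auto)
    also have "\<dots> \<le> \<rho> * 1" using t \<rho> by (intro mult_left_mono) auto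
    finally have "dist p (\<phi> (x, t)) \<le> dist p x + \<rho>"
      using dist_triangle[of p "\<phi> (x, t)" x] by (simp add: \<phi>_def dist_norm)
    then show ?thesis using x by simp
  qed
  have \<pi>\<phi>: "\<pi> (\<phi> (x, t)) = \<phi> (x, t)" if "x \<in> ball p \<rho>" "t \<in> {-1<..<1}" for x t
    using \<phi>_in[OF that] by (intro \<pi>_id) auto
  have shift: "((\<lambda>s. c + f s) has_vector_derivative f') (at t)"
    if "(f has_vector_derivative f') (at t within {-1..1})" "t \<in> {-1<..<1}"
    for c f' :: "'c::real_normed_vector" and f t
    using that has_vector_derivative_add[OF has_vector_derivative_const[of c] that(1)] interior by simp
  have "local_flow u W p \<rho> \<phi> (\<lambda>z. id_blinfun + F0 z) (\<lambda>z. id_blinfun + G0 z)"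
  proof
    fix x and t :: real assume x: "x \<in> ball p \<rho>" and t: "t \<in> {-1<..<1}"
    then have t1: "t \<in> {-1..1}" by auto
    show "((\<lambda>t. \<phi> (x, t)) has_vector_derivative u (\<phi> (x, t))) (at t)"
      using shift[OF \<psi>(3)[OF t1] t, of x x] \<pi>\<phi>[OF x t] by (simp add: \<phi>_def)
    show "((\<lambda>t. id_blinfun + F0 (x, t)) has_vector_derivative
        deriv_blinfun u (\<phi> (x, t)) o\<^sub>L (id_blinfun + F0 (x, t))) (at t)"
      using shift[OF F0(3)[OF t1] t, of id_blinfun x] \<pi>\<phi>[OF x t] by (simp add: A_def)
    show "((\<lambda>t. id_blinfun + G0 (x, t)) has_vector_derivative
        - ((id_blinfun + G0 (x, t)) o\<^sub>L deriv_blinfun u (\<phi> (x, t)))) (at t)"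
      using shift[OF G0(3)[OF t1] t, of id_blinfun x] \<pi>\<phi>[OF x t] by (simp add: A_def)
  qed (use assms \<phi>_in \<phi>_cont F0 G0 \<psi>(1,2) in
      \<open>auto simp: \<phi>_def intro!: continuous_intros intro: continuous_on_subset\<close>)
  then show thesis by (rule that)
qed

section \<open>First integrals\<close>

text \<open>Each point is carried along its orbit to the hyperplane through \<open>p\<close> orthogonal to \<open>v p\<close>. After dividing
  \<open>v\<close> by its component along \<open>v p\<close> the required time is an affine function \<open>\<tau>\<close> of the point, so that
  \<open>H x = \<phi> (x, \<tau> x)\<close> is smooth. Moving \<open>x\<close> along the field changes \<open>\<phi>\<close> by \<open>u(\<phi>)\<close> through the
  starting point and by \<open>- u(\<phi>)\<close> through \<open>\<tau>\<close>, so \<open>H\<close> is constant along orbits; at \<open>p\<close> its derivative is the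
  orthogonal projection along \<open>v p\<close>. The components of \<open>H\<close> in directions orthogonal to \<open>v p\<close> are thus a full
  set of independent first integrals.\<close>

theorem first_integrals_transverse_to_field:
  fixes v :: "'a::euclidean_space \<Rightarrow> 'a"
  assumes W: "open W" and v: "smooth_on W v" and p: "p \<in> W" "v p \<noteq> 0"
  obtains U H where "open U" "p \<in> U" "U \<subseteq> W" "smooth_on U H"
    "\<And>x. x \<in> U \<Longrightarrow> frechet_derivative H (at x) (v x) = 0"
    "\<And>h. frechet_derivative H (at p) h = h - ((v p \<bullet> h) / (v p \<bullet> v p)) *\<^sub>R v p"
proof -
  define e where "e = v p"
  define W0 where "W0 = {x \<in> W. 0 < e \<bullet> v x}"
  have Ck_v: "Ck_on k W v" for k using v by (simp add: smooth_on_def)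
  have "open (W \<inter> (\<lambda>x. e \<bullet> v x) -` {0<..})"
    by (intro continuous_open_preimage continuous_intros Ck_on_continuous[OF Ck_v] W open_greaterThan)
  then have W0: "open W0" by (simp add: W0_def vimage_def Int_def)
  have W0_W: "W0 \<subseteq> W" and p0: "p \<in> W0" using p by (auto simp: W0_def e_def)
  define u0 where "u0 x = inverse (e \<bullet> v x) *\<^sub>R v x" for x
  have Ck_u0: "Ck_on k W0 u0" for k
    unfolding u0_def
    by (intro Ck_on_bilinear[OF W0 bounded_bilinear_scaleR] Ck_on_inverse[OF W0]
        Ck_on_bounded_linear[OF W0 bounded_linear_inner_right] Ck_on_subset[OF Ck_v W0_W])
      (auto simp: W0_def)
  obtain r where r: "0 < r" "cball p r \<subseteq> W0"
    using open_contains_cball[of W0] W0 p0 by blast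
  define \<rho> where "\<rho> = r / 2"
  have \<rho>: "0 < \<rho>" "cball p (2 * \<rho>) \<subseteq> W0" using r by (auto simp: \<rho>_def)
  obtain M where M: "0 < M" "\<And>x. x \<in> cball p (2 * \<rho>) \<Longrightarrow> norm (u0 x) \<le> M"
    using compact_imp_bounded[OF compact_continuous_image[OF
          continuous_on_subset[OF Ck_on_continuous[OF Ck_u0] \<rho>(2)] compact_cball]]
    by (auto simp: bounded_pos)
  obtain L where L: "0 < L" "\<And>x. x \<in> cball p (2 * \<rho>) \<Longrightarrow> norm (deriv_blinfun u0 x) \<le> L"
    using compact_imp_bounded[OF compact_continuous_image[OF
          continuous_on_subset[OF deriv_blinfun_continuous_on[OF W0 Ck_u0] \<rho>(2)] compact_cball]]
    by (auto simp: bounded_pos)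
  \<comment> \<open>a factor that slows the field down until unit time and the smallness bounds of the local flow suffice\<close>
  define \<delta> where "\<delta> = min (\<rho> / M) (1 / (4 * L))"
  have \<delta>: "0 < \<delta>" "\<delta> * M \<le> \<rho>" "\<delta> * L \<le> 1/4"
    using \<rho>(1) M(1) L(1) by (auto simp: \<delta>_def min_def field_simps)
  define u where "u x = \<delta> *\<^sub>R u0 x" for x
  have u: "smooth_on W0 u"
    unfolding smooth_on_def u_def
    by (intro allI Ck_on_bounded_linear[OF W0 bounded_linear_scaleR_right] Ck_u0)
  have e_u: "e \<bullet> u x = \<delta>" if "x \<in> W0" for x
    using that by (auto simp: u_def u0_def W0_def)
  have du: "deriv_blinfun u x = \<delta> *\<^sub>R deriv_blinfun u0 x" if "x \<in> W0" for x
  proof -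
    have "(u has_derivative (\<lambda>h. \<delta> *\<^sub>R deriv_blinfun u0 x h)) (at x)"
      unfolding u_def by (intro has_derivative_scaleR_right Ck_on_Suc_has_deriv_blinfun[OF Ck_u0 that])
    from deriv_blinfun_eq[OF this] show ?thesis by (intro blinfun_eqI) (simp add: blinfun.scaleR_left)
  qed
  have bounds: "norm (u x) \<le> \<rho>" "norm (deriv_blinfun u x) \<le> 1/4" if "x \<in> cball p (2 * \<rho>)" for x
  proof -
    have x: "x \<in> W0" using \<rho>(2) that by blast
    have "\<delta> * norm (u0 x) \<le> \<delta> * M" by (rule mult_left_mono[OF M(2)[OF that]]) (use \<delta>(1) in simp)
    from order_trans[OF this \<delta>(2)] show "norm (u x) \<le> \<rho>" using \<delta>(1) by (simp add: u_def)
    have "\<delta> * norm (deriv_blinfun u0 x) \<le> \<delta> * L" by (rule mult_left_mono[OF L(2)[OF that]]) (use \<delta>(1) in simp)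
    from order_trans[OF this \<delta>(3)] show "norm (deriv_blinfun u x) \<le> 1/4" using \<delta>(1) by (simp add: du[OF x])
  qed
  obtain \<phi> F G where "local_flow u W0 p \<rho> \<phi> F G"
    using local_flow_exists[OF W0 u \<rho>(2,1) bounds] .
  then interpret local_flow u W0 p \<rho> \<phi> F G .
  define \<tau> where "\<tau> x = (e \<bullet> p) / \<delta> + (- 1 / \<delta>) * (e \<bullet> x)" for x
  define U where "U = ball p \<rho> \<inter> \<tau> -` {-1<..<1}"
  have \<tau>_cont: "continuous_on UNIV \<tau>" unfolding \<tau>_def by (intro continuous_intros)
  have U: "open U" unfolding U_def by (intro open_Int open_ball open_vimage open_greaterThanLessThan \<tau>_cont)
  have \<tau>p: "\<tau> p = 0" by (simp add: \<tau>_def)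
  have pU: "p \<in> U" using \<rho>(1) \<tau>p by (simp add: U_def)
  have UW0: "U \<subseteq> W0" using r by (auto simp: U_def \<rho>_def subset_iff)
  have U_in: "x \<in> ball p \<rho>" "\<tau> x \<in> {-1<..<1}" if "x \<in> U" for x using that by (auto simp: U_def)
  define H where "H x = \<phi> (x, \<tau> x)" for x
  have Ck_H: "Ck_on k U H" for k
  proof -
    have "Ck_on k U \<tau>"
      unfolding \<tau>_def
      by (intro Ck_on_add[OF U] Ck_on_const Ck_on_linear[OF U] bounded_linear_intros)
    then have 1: "Ck_on k U (\<lambda>x. (x, \<tau> x))"
      by (intro Ck_on_Pair[OF U] Ck_on_linear[OF U bounded_linear_ident])
    have 2: "Ck_on k D \<phi>" using flow_smooth by (simp add: smooth_on_def)
    show ?thesis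
      unfolding H_def by (rule Ck_on_compose[OF U 2 1]) (use U_in in \<open>simp add: D_def\<close>)
  qed
  have DH: "frechet_derivative H (at x) = (\<lambda>h. F (x, \<tau> x) h + ((- 1 / \<delta>) * (e \<bullet> h)) *\<^sub>R u (\<phi> (x, \<tau> x)))"
    if x: "x \<in> U" for x
  proof -
    have "((\<lambda>x. (x, \<tau> x)) has_derivative (\<lambda>h. (h, (- 1 / \<delta>) * (e \<bullet> h)))) (at x)"
      unfolding \<tau>_def using \<delta>(1) by (auto intro!: derivative_eq_intros)
    from has_derivative_compose[OF this flow_has_derivative[OF U_in[OF x]]]
    have "(H has_derivative (\<lambda>h. F (x, \<tau> x) h + ((- 1 / \<delta>) * (e \<bullet> h)) *\<^sub>R u (\<phi> (x, \<tau> x)))) (at x)"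
      by (simp add: H_def[abs_def])
    from frechet_derivative_at[OF this] show ?thesis by simp
  qed
  show thesis
  proof (rule that[OF U pU _ _ , of H])
    show "U \<subseteq> W" using UW0 W0_W by simp
    show "smooth_on U H" using Ck_H by (simp add: smooth_on_def)
    show "frechet_derivative H (at x) (v x) = 0" if x: "x \<in> U" for x
    proof -
      have xW: "x \<in> W0" using UW0 x by blast
      have "frechet_derivative H (at x) (u x) = 0"
        using DH[OF x] F_u[OF U_in[OF x]] e_u[OF xW] \<delta>(1) by simp
      moreover obtain c where "v x = c *\<^sub>R u x"
      proof
        show "v x = ((e \<bullet> v x) / \<delta>) *\<^sub>R u x"
          using xW \<delta>(1) by (simp add: u_def u0_def W0_def)
      qed
      ultimately show ?thesis
        using has_derivative_linear[OF Ck_on_Suc_has_derivative[OF Ck_H x]] by (simp add: linear_cmul)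
    qed
    show "frechet_derivative H (at p) h = h - ((v p \<bullet> h) / (v p \<bullet> v p)) *\<^sub>R v p" for h
      using DH[OF pU] \<tau>p flow_0[of p] F_0[of p] \<rho>(1) \<delta>(1)
      by (simp add: id_blinfun.rep_eq u_def u0_def e_def divide_inverse)
  qed
qed

section \<open>Gradients, curl and the cross product\<close>

lemma gradient_eq_sum: "gradient H x = (\<Sum>i\<in>UNIV. frechet_derivative H (at x) (axis i 1) *\<^sub>R axis i 1)"
  by (simp add: gradient_def vec_eq_iff axis_def if_distrib cong: if_cong)

lemma Ck_on_gradient:
  assumes "open S" "Ck_on (Suc k) S H"
  shows "Ck_on k S (gradient H)"
proof -
  have "Ck_on k S (\<lambda>x. \<Sum>i\<in>UNIV. frechet_derivative H (at x) (axis i 1) *\<^sub>R axis i 1)"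
    using assms(2) by (intro Ck_on_sum Ck_on_bounded_linear[OF _ bounded_linear_scaleR_left] assms(1)) simp
  then show ?thesis by (simp add: gradient_eq_sum[abs_def])
qed

lemma inner_gradient:
  assumes "H differentiable (at x)"
  shows "h \<bullet> gradient H x = frechet_derivative H (at x) h"
proof -
  have "frechet_derivative H (at x) h = (\<Sum>i\<in>UNIV. h $ i *\<^sub>R frechet_derivative H (at x) (axis i 1))"
    using linear_frechet_derivative[OF assms]
    by (subst basis_expansion[of h, symmetric]) (simp add: linear_sum linear_cmul scalar_mult_eq_scaleR)
  then show ?thesis by (simp add: gradient_def inner_vec_def)
qed

lemma gradient_derivative_symmetric:
  assumes S: "open S" and H: "Ck_on (Suc (Suc 0)) S H" and x: "x \<in> S"
  shows "frechet_derivative (gradient H) (at x) (axis i 1) $ j = frechet_derivative (gradient H) (at x) (axis j 1) $ i"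
proof -
  have comp: "frechet_derivative (gradient H) (at x) h $ j =
      frechet_derivative (\<lambda>y. frechet_derivative H (at y) (axis j 1)) (at x) h" for h j
  proof -
    have "((\<lambda>y. gradient H y $ j) has_derivative (\<lambda>h. frechet_derivative (gradient H) (at x) h $ j)) (at x)"
      by (rule bounded_linear.has_derivative[OF bounded_linear_vec_nth
            Ck_on_Suc_has_derivative[OF Ck_on_gradient[OF S H] x]])
    from fun_cong[OF frechet_derivative_at[OF this], of h] show ?thesis by (simp add: gradient_def)
  qed
  show ?thesis unfolding comp by (rule second_derivative_symmetric[OF S H x])
qed

text \<open>In the situation of interest \<open>J\<close> is the product of a function, with value \<open>f\<close> and derivative \<open>f'\<close> at \<open>x\<close>,
  and a field, with value \<open>g\<close> and derivative \<open>g'\<close>; symmetry of \<open>g'\<close> means that this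
  field has zero curl at \<open>x\<close>. Only the gradient of the function, crossed with \<open>g\<close>, is left of \<open>curl J\<close>, and it
  is orthogonal to \<open>g\<close>.\<close>

lemma inner_curl_scaled_symmetric:
  fixes J :: "real^3 \<Rightarrow> real^3"
  assumes J': "(J has_derivative (\<lambda>h. f *\<^sub>R g' h + f' h *\<^sub>R g)) (at x)" and J: "J x = f *\<^sub>R g"
    and sym: "\<And>i j. g' (axis i 1) $ j = g' (axis j 1) $ i"
  shows "J x \<bullet> curl J x = 0"
proof -
  have D: "jacobian J (at x) $ i $ j = f * g' (axis j 1) $ i + f' (axis j 1) * g $ i" for i j
    unfolding jacobian_def frechet_derivative_at[OF J', symmetric] by (simp add: matrix_def)
  show ?thesis
    unfolding curl_def Let_def D J inner_vec_def sum_3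
    using sym[of 3 2] sym[of 1 3] sym[of 2 1] by (simp add: algebra_simps)
qed

lemma cross3_independent:
  assumes "cross3 a b \<noteq> 0"
  shows "a \<noteq> b \<and> independent {a, b}"
proof -
  have ab: "a \<noteq> b" using assms by auto
  have "a \<notin> span {b}" using assms by (auto simp: span_singleton cross_mult_left)
  moreover have "b \<noteq> 0" using assms by auto
  ultimately show ?thesis using ab by (simp add: independent_insert)
qed

lemma bounded_bilinear_cross3: "bounded_bilinear cross3"
  using bilinear_cross bilinear_conv_bounded_bilinear by blast

text \<open>The triple product expansion gives \<open>v \<times> (a \<times> b) = 0\<close>, and a second expansion recovers \<open>v\<close>.\<close>

lemma parallel_to_cross3:
  assumes "v \<bullet> a = 0" "v \<bullet> b = 0" "cross3 a b \<noteq> 0"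
  shows "v = ((v \<bullet> cross3 a b) / (cross3 a b \<bullet> cross3 a b)) *\<^sub>R cross3 a b"
proof -
  define n where "n = cross3 a b"
  have "cross3 v n = 0" unfolding n_def Lagrange using assms(1,2) by simp
  then have "cross3 n (cross3 v n) = 0" by simp
  then have "(n \<bullet> n) *\<^sub>R v = (n \<bullet> v) *\<^sub>R n" unfolding Lagrange by simp
  moreover have "n \<bullet> n \<noteq> 0" using assms(3) by (simp add: n_def)
  ultimately have "v = ((n \<bullet> v) / (n \<bullet> n)) *\<^sub>R n"
    by (metis (no_types) divide_inverse_commute real_vector.scale_scale left_inverse scaleR_one)
  then show ?thesis by (simp add: n_def inner_commute)
qed

text \<open>A nonvanishing field along which both functions are constant is \<open>f (grad H1 \<times> grad H2)\<close> for a smooth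
  function \<open>f\<close> without zeros. The vectors \<open>J1 = f grad H1\<close> and \<open>J2 = - f grad H2\<close> then have the
  Hamiltonians \<open>H2\<close> and \<open>H1\<close>, and every combination \<open>J1 + c J2 = f grad (H1 - c H2)\<close> is a multiple of a
  gradient, so it satisfies the Jacobi identity.\<close>

theorem compatible_pair_from_first_integrals:
  fixes v :: "real^3 \<Rightarrow> real^3"
  assumes U: "open U" and v: "smooth_on U v" and H1: "smooth_on U H1" and H2: "smooth_on U H2"
    and vH1: "\<And>x. x \<in> U \<Longrightarrow> frechet_derivative H1 (at x) (v x) = 0"
    and vH2: "\<And>x. x \<in> U \<Longrightarrow> frechet_derivative H2 (at x) (v x) = 0"
    and nz: "\<And>x. x \<in> U \<Longrightarrow> v x \<bullet> cross3 (gradient H1 x) (gradient H2 x) \<noteq> 0"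
  shows "\<exists>J1 J2. smooth_on U J1 \<and> smooth_on U J2 \<and>
    (\<forall>x\<in>U. J1 x \<noteq> J2 x \<and> independent {J1 x, J2 x}) \<and>
    poisson_vector_for_on U v J1 \<and> poisson_vector_for_on U v J2 \<and> compatible_on U J1 J2"
proof -
  define n where "n x = cross3 (gradient H1 x) (gradient H2 x)" for x
  define f where "f x = (v x \<bullet> n x) * inverse (n x \<bullet> n x)" for x
  have Ck: "Ck_on k U v" "Ck_on k U H1" "Ck_on k U H2" for k using v H1 H2 by (auto simp: smooth_on_def)
  have g: "Ck_on k U (gradient H1)" "Ck_on k U (gradient H2)" for k
    by (rule Ck_on_gradient[OF U Ck(2)], rule Ck_on_gradient[OF U Ck(3)])
  have n: "Ck_on k U n" for k unfolding n_def by (intro Ck_on_bilinear[OF U bounded_bilinear_cross3] g)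
  have n0: "n x \<noteq> 0" if "x \<in> U" for x using nz[OF that] by (auto simp: n_def)
  have f: "Ck_on k U f" for k
    unfolding f_def using n0
    by (intro Ck_on_bilinear[OF U bounded_bilinear_mult] Ck_on_inverse[OF U]
        Ck_on_bilinear[OF U bounded_bilinear_inner] Ck(1) n) simp
  have f0: "f x \<noteq> 0" if "x \<in> U" for x using nz[OF that] n0[OF that] by (simp add: f_def n_def)
  have v_eq: "v x = f x *\<^sub>R n x" if x: "x \<in> U" for x
  proof -
    have "H1 differentiable at x" "H2 differentiable at x"
      using Ck(2)[of "Suc 0"] Ck(3)[of "Suc 0"] x by auto
    then have "v x \<bullet> gradient H1 x = 0" "v x \<bullet> gradient H2 x = 0"
      using vH1[OF x] vH2[OF x] by (simp_all add: inner_gradient)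
    from parallel_to_cross3[OF this] n0[OF x] show ?thesis by (simp add: f_def n_def divide_inverse)
  qed
  \<comment> \<open>the whole pencil at once: \<open>J1 = J 1 0\<close>, \<open>J2 = J 0 (-1)\<close> and \<open>J1 + c J2 = J 1 (- c)\<close>\<close>
  define J where "J a b x = f x *\<^sub>R (a *\<^sub>R gradient H1 x + b *\<^sub>R gradient H2 x)" for a b :: real and x
  have g_comb: "Ck_on k U (\<lambda>x. a *\<^sub>R gradient H1 x + b *\<^sub>R gradient H2 x)" for a b k
    by (intro Ck_on_add[OF U] Ck_on_bounded_linear[OF U bounded_linear_scaleR_right] g)
  have J_smooth: "smooth_on U (J a b)" for a b
    unfolding smooth_on_def J_def by (intro allI Ck_on_bilinear[OF U bounded_bilinear_scaleR] f g_comb)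
  have jacobi: "jacobi_identity_on U (J a b)" for a b
    unfolding jacobi_identity_on_def
  proof
    fix x assume x: "x \<in> U"
    let ?g' = "\<lambda>h. a *\<^sub>R frechet_derivative (gradient H1) (at x) h + b *\<^sub>R frechet_derivative (gradient H2) (at x) h"
    have "(J a b has_derivative (\<lambda>h. f x *\<^sub>R ?g' h + frechet_derivative f (at x) h *\<^sub>R (a *\<^sub>R gradient H1 x + b *\<^sub>R gradient H2 x))) (at x)"
      unfolding J_def
      by (intro has_derivative_scaleR has_derivative_add has_derivative_scaleR_right
          Ck_on_Suc_has_derivative[OF f x] Ck_on_Suc_has_derivative[OF g(1) x] Ck_on_Suc_has_derivative[OF g(2) x])
    then show "J a b x \<bullet> curl (J a b) x = 0"
    proof (rule inner_curl_scaled_symmetric)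
      show "?g' (axis i 1) $ j = ?g' (axis j 1) $ i" for i j
        using gradient_derivative_symmetric[OF U Ck(2) x, of i j] gradient_derivative_symmetric[OF U Ck(3) x, of i j]
        by simp
    qed (simp add: J_def)
  qed
  have J12: "cross3 (J 1 0 x) (J 0 (-1) x) \<noteq> 0" if "x \<in> U" for x
    using f0[OF that] n0[OF that] by (simp add: J_def n_def cross_mult_left cross_mult_right)
  have ind: "J 1 0 x \<noteq> J 0 (-1) x \<and> independent {J 1 0 x, J 0 (-1) x}" if "x \<in> U" for x
    by (rule cross3_independent[OF J12[OF that]])
  have v1: "v x = cross3 (J 1 0 x) (gradient H2 x)" if "x \<in> U" for x
    using v_eq[OF that] by (simp add: J_def n_def cross_mult_left)
  have v2: "v x = cross3 (J 0 (-1) x) (gradient H1 x)" if "x \<in> U" for x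
    using v_eq[OF that] cross_skew[of "gradient H1 x" "gradient H2 x"] by (simp add: J_def n_def cross_mult_left)
  have J_nz: "J 1 0 x \<noteq> 0 \<and> J 0 (-1) x \<noteq> 0" if "x \<in> U" for x using J12[OF that] by auto
  have "compatible_on U (J 1 0) (J 0 (-1))"
    unfolding compatible_on_def
  proof
    fix c
    have "(\<lambda>x. J 1 0 x + c *\<^sub>R J 0 (-1) x) = J 1 (- c)"
      by (simp add: J_def fun_eq_iff scaleR_add_right scaleR_diff_right mult.commute)
    then show "jacobi_identity_on U (\<lambda>x. J 1 0 x + c *\<^sub>R J 0 (-1) x)" using jacobi by simp
  qed
  moreover have "poisson_vector_for_on U v (J 1 0)" "poisson_vector_for_on U v (J 0 (-1))"
    using J_smooth J_nz jacobi v1 v2 H1 H2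
    unfolding poisson_vector_for_on_def poisson_vector_on_def by blast+
  ultimately show ?thesis using J_smooth ind by blast
qed

theorem proposition2:
  fixes v :: "real^3 \<Rightarrow> real^3" and W :: "(real^3) set" and p :: "real^3"
  assumes "open W" and "smooth_on W v" and "p \<in> W" and "v p \<noteq> 0"
  shows "\<exists>U J1 J2. open U \<and> p \<in> U \<and> U \<subseteq> W \<and>
           smooth_on U J1 \<and> smooth_on U J2 \<and>
           (\<forall>x\<in>U. J1 x \<noteq> J2 x \<and> independent {J1 x, J2 x}) \<and>
           poisson_vector_for_on U v J1 \<and> poisson_vector_for_on U v J2 \<and>
           compatible_on U J1 J2"
proof -
  obtain V H where V: "open V" "p \<in> V" "V \<subseteq> W" and H: "smooth_on V H"
    and vH: "\<And>x. x \<in> V \<Longrightarrow> frechet_derivative H (at x) (v x) = 0"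
    and Hp: "\<And>h. frechet_derivative H (at p) h = h - ((v p \<bullet> h) / (v p \<bullet> v p)) *\<^sub>R v p"
    using first_integrals_transverse_to_field[OF assms] by blast
  obtain i :: 3 where i: "cross3 (v p) (axis i 1) \<noteq> 0" using cross_basis_nonzero[OF assms(4)] by blast
  \<comment> \<open>two directions spanning the plane orthogonal to \<open>v p\<close>; the components of \<open>H\<close> along them have gradients \<open>m1\<close>, \<open>m2\<close> at \<open>p\<close>\<close>
  define m1 where "m1 = cross3 (v p) (axis i 1)"
  define m2 where "m2 = cross3 (v p) m1"
  have m: "m1 \<bullet> v p = 0" "m2 \<bullet> v p = 0" by (simp_all add: m1_def m2_def dot_cross_self)
  have "cross3 m1 m2 = (m1 \<bullet> m1) *\<^sub>R v p" unfolding m2_def Lagrange using m by simp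
  then have m12: "v p \<bullet> cross3 m1 m2 \<noteq> 0" using i assms(4) by (simp add: m1_def)
  define K where "K a x = a \<bullet> H x" for a x
  have Ck_H: "Ck_on k V H" for k using H by (simp add: smooth_on_def)
  have Ck_K: "Ck_on k V (K a)" for k a
    unfolding K_def by (rule Ck_on_bounded_linear[OF V(1) bounded_linear_inner_right Ck_H])
  have DK: "frechet_derivative (K a) (at x) h = a \<bullet> frechet_derivative H (at x) h" if "x \<in> V" for a x h
    unfolding K_def
    using frechet_derivative_at[OF has_derivative_inner_right[OF Ck_on_Suc_has_derivative[OF Ck_H that]]] by metis
  have grad: "gradient (K a) p = a" if "a \<bullet> v p = 0" for a
    using that by (simp add: gradient_def DK[OF V(2)] Hp inner_diff_right inner_axis vec_eq_iff)
  define n where "n x = v x \<bullet> cross3 (gradient (K m1) x) (gradient (K m2) x)" for x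
  \<comment> \<open>this single condition makes the gradients independent and \<open>v\<close> nonzero\<close>
  define U where "U = {x \<in> V. n x \<noteq> 0}"
  have Ck_v: "Ck_on k V v" for k using assms(2) by (intro Ck_on_subset[OF _ V(3)]) (simp add: smooth_on_def)
  have "Ck_on 0 V n"
    unfolding n_def
    by (intro Ck_on_bilinear[OF V(1) bounded_bilinear_inner] Ck_on_bilinear[OF V(1) bounded_bilinear_cross3]
        Ck_on_gradient[OF V(1)] Ck_K Ck_v)
  then have U: "open U"
    unfolding U_def using continuous_open_preimage[of V n "- {0}"] V(1) by (simp add: vimage_def Int_def open_Compl)
  have UV: "U \<subseteq> V" by (auto simp: U_def)
  have "p \<in> U" using V(2) m12 by (simp add: U_def n_def grad m)
  moreover have "\<exists>J1 J2. smooth_on U J1 \<and> smooth_on U J2 \<and>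
    (\<forall>x\<in>U. J1 x \<noteq> J2 x \<and> independent {J1 x, J2 x}) \<and>
    poisson_vector_for_on U v J1 \<and> poisson_vector_for_on U v J2 \<and> compatible_on U J1 J2"
  proof (rule compatible_pair_from_first_integrals[OF U])
    show "smooth_on U v" "smooth_on U (K m1)" "smooth_on U (K m2)"
      using Ck_v Ck_K UV by (auto simp: smooth_on_def intro: Ck_on_subset)
    show "frechet_derivative (K m1) (at x) (v x) = 0" "frechet_derivative (K m2) (at x) (v x) = 0"
      "v x \<bullet> cross3 (gradient (K m1) x) (gradient (K m2) x) \<noteq> 0" if "x \<in> U" for x
      using that UV DK vH by (auto simp: U_def n_def)
  qed
  ultimately show ?thesis using U UV V(3) by (meson subset_trans)
qed

end
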